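(* Let $(X,T)$ and $(Y,S)$ be minimal systems and let $\pi:(X,T)\to(Z,R)$ be a factor map. (1) If $X$ and $Y$ are quasi-disjoint, then $Z$ and $Y$ are quasi-disjoint. (2) If $X$ and $Y$ are strongly quasi-disjoint, then $Z$ and $Y$ are strongly quasi-disjoint.
   Context: A system $(X,T)$ is a compact metric space $X$ with a homeomorphism $T:X\to X$. It is minimal if every orbit $\{T^nx:n\in\mathbb Z\}$ is dense. A minimal subset is a nonempty closed invariant set in which every orbit is dense. A factor map (homomorphism) $\pi:(X,T)\to(Y,S)$ is a continuous surjection with $\pi\circ T=S\circ\pi$. A system is equicontinuous if for every $\epsilon>0$ there is $\delta>0$ such that $\rho(x,y)<\delta$ implies $\rho(T^nx,T^ny)<\epsilon$ for all $n\in\mathbb Z$. For a minimal system $(X,T)$, $\pi_X:X\to X_{eq}$ denotes its maximal equicontinuous factor (every factor map from $X$ to an equicontinuous system factors through $\pi_X$). A joining of $(X,T)$ and $(Y,S)$ is a closed $T\times S$-invariant subset of $X\times Y$ with full projections onto $X$ and onto $Y$. Minimal systems $(X,T)$, $(Y,S)$ are quasi-disjoint if $X\times Y$ is the only joining $J$ of $X$ and $Y$ satisfying $(\pi_X\times\pi_Y)(J)=X_{eq}\times Y_{eq}$. A maximal common equicontinuous factor of minimal systems $(X,T)$ and $(Y,S)$ is an equicontinuous system $(E,Q)$ with factor maps $\alpha:X\to E$, $\beta:Y\to E$ such that for every equicontinuous system $(W,P)$ and factor maps $\phi:X\to W$, $\psi:Y\to W$ there are factor maps $\eta_1,\eta_2:E\to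 W$ with $\phi=\eta_1\alpha$ and $\psi=\eta_2\beta$. It exists and is unique up to isomorphism, and is denoted $Eq(X,Y)$. Being minimal and equicontinuous, it is identified with a compact abelian metrizable group on which its homeomorphism is translation by a fixed element. Put $\gamma:X\times Y\to Eq(X,Y)$, $\gamma(x,y)=\alpha(x)-\beta(y)$. Minimal systems $X$ and $Y$ are strongly quasi-disjoint if there is a residual set $\Omega\subset Eq(X,Y)$ such that $\gamma^{-1}(z)$ is a minimal subset of $(X\times Y,T\times S)$ for each $z\in\Omega$. *)

theory Defs
  imports "HOL-Analysis.Analysis" "HOL-Algebra.Group"
begin

(* clashes with the topological closure_of *)
no_notation eq_closure_of (\<open>closure'_of\<index>\<close>)

section \<open>Systems, orbits, minimality\<close>

text \<open>A system is a compact \<^typ>\<open>'a metric\<close> (carrier \<^term>\<open>mspace X\<close>) together with a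
  homeomorphism. The values of the map off the carrier are irrelevant.\<close>

definition dyn_system :: "'a metric \<Rightarrow> ('a \<Rightarrow> 'a) \<Rightarrow> bool" where
  "dyn_system X T \<longleftrightarrow>
     compact_space (mtopology_of X) \<and> homeomorphic_map (mtopology_of X) (mtopology_of X) T"

definition ziter :: "'a set \<Rightarrow> ('a \<Rightarrow> 'a) \<Rightarrow> int \<Rightarrow> 'a \<Rightarrow> 'a" where
  "ziter A f n = (if n \<ge> 0 then f ^^ nat n else inv_into A f ^^ nat (- n))"

definition zorbit :: "'a set \<Rightarrow> ('a \<Rightarrow> 'a) \<Rightarrow> 'a \<Rightarrow> 'a set" where
  "zorbit A f x = range (\<lambda>n. ziter A f n x)"

definition minimal_system :: "'a metric \<Rightarrow> ('a \<Rightarrow> 'a) \<Rightarrow> bool" where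
  "minimal_system X T \<longleftrightarrow> dyn_system X T \<and> mspace X \<noteq> {} \<and>
     (\<forall>x\<in>mspace X. mtopology_of X closure_of zorbit (mspace X) T x = mspace X)"

text \<open>Stated for topologies, so that it applies to the product system on
  \<^term>\<open>prod_topology (mtopology_of X) (mtopology_of Y)\<close>. Invariance is two-sided, as
  appropriate for an action of the integers.\<close>

definition minimal_subset :: "'a topology \<Rightarrow> ('a \<Rightarrow> 'a) \<Rightarrow> 'a set \<Rightarrow> bool" where
  "minimal_subset \<T> f M \<longleftrightarrow> M \<noteq> {} \<and> closedin \<T> M \<and> f ` M = M \<and>
     (\<forall>x\<in>M. M \<subseteq> \<T> closure_of zorbit (topspace \<T>) f x)"

definition factor_map ::
    "'a metric \<Rightarrow> ('a \<Rightarrow> 'a) \<Rightarrow> 'b metric \<Rightarrow> ('b \<Rightarrow> 'b) \<Rightarrow> ('a \<Rightarrow> 'b) \<Rightarrow> bool" where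
  "factor_map X T Y S p \<longleftrightarrow> continuous_map (mtopology_of X) (mtopology_of Y) p \<and>
     p ` mspace X = mspace Y \<and> (\<forall>x\<in>mspace X. p (T x) = S (p x))"

definition equicontinuous_system :: "'a metric \<Rightarrow> ('a \<Rightarrow> 'a) \<Rightarrow> bool" where
  "equicontinuous_system X T \<longleftrightarrow> dyn_system X T \<and>
     (\<forall>\<epsilon>>0. \<exists>\<delta>>0. \<forall>x\<in>mspace X. \<forall>y\<in>mspace X. mdist X x y < \<delta> \<longrightarrow>
        (\<forall>n. mdist X (ziter (mspace X) T n x) (ziter (mspace X) T n y) < \<epsilon>))"


section \<open>Maximal equicontinuous factors\<close>

text \<open>The test systems \<open>W\<close> below are carried by subsets of the type of \<open>X\<close>. Every factor of
  \<open>X\<close> is isomorphic to such a system (choose a section of the factor map), so nothing is lost: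
  the universal property for test systems on arbitrary types is derived below as
  \<open>max_eq_factor_universal\<close> and \<open>max_common_eq_factor_universal\<close>.\<close>

definition max_eq_factor ::
    "'a metric \<Rightarrow> ('a \<Rightarrow> 'a) \<Rightarrow> 'e metric \<Rightarrow> ('e \<Rightarrow> 'e) \<Rightarrow> ('a \<Rightarrow> 'e) \<Rightarrow> bool" where
  "max_eq_factor X T E Q p \<longleftrightarrow> equicontinuous_system E Q \<and> factor_map X T E Q p \<and>
     (\<forall>(W :: 'a metric) P \<phi>. equicontinuous_system W P \<and> factor_map X T W P \<phi> \<longrightarrow>
        (\<exists>\<eta>. factor_map E Q W P \<eta> \<and> (\<forall>x\<in>mspace X. \<phi> x = \<eta> (p x))))"

definition max_common_eq_factor ::
    "'a metric \<Rightarrow> ('a \<Rightarrow> 'a) \<Rightarrow> 'b metric \<Rightarrow> ('b \<Rightarrow> 'b) \<Rightarrow>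
     'e metric \<Rightarrow> ('e \<Rightarrow> 'e) \<Rightarrow> ('a \<Rightarrow> 'e) \<Rightarrow> ('b \<Rightarrow> 'e) \<Rightarrow> bool" where
  "max_common_eq_factor X T Y S E Q \<alpha> \<beta> \<longleftrightarrow> equicontinuous_system E Q \<and>
     factor_map X T E Q \<alpha> \<and> factor_map Y S E Q \<beta> \<and>
     (\<forall>(W :: 'a metric) P \<phi> \<psi>.
        equicontinuous_system W P \<and> factor_map X T W P \<phi> \<and> factor_map Y S W P \<psi> \<longrightarrow>
        (\<exists>\<eta>1 \<eta>2. factor_map E Q W P \<eta>1 \<and> factor_map E Q W P \<eta>2 \<and>
           (\<forall>x\<in>mspace X. \<phi> x = \<eta>1 (\<alpha> x)) \<and> (\<forall>y\<in>mspace Y. \<psi> y = \<eta>2 (\<beta> y))))"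


section \<open>Quasi-disjointness\<close>

definition joining ::
    "'a metric \<Rightarrow> ('a \<Rightarrow> 'a) \<Rightarrow> 'b metric \<Rightarrow> ('b \<Rightarrow> 'b) \<Rightarrow> ('a \<times> 'b) set \<Rightarrow> bool" where
  "joining X T Y S J \<longleftrightarrow> closedin (prod_topology (mtopology_of X) (mtopology_of Y)) J \<and>
     map_prod T S ` J = J \<and> fst ` J = mspace X \<and> snd ` J = mspace Y"

text \<open>Maximal equicontinuous factors exist and are unique up to isomorphism, so it does not
  matter which ones are used; they can always be carried by subsets of the types of \<open>X\<close> and \<open>Y\<close>.\<close>

definition quasi_disjoint ::
    "'a metric \<Rightarrow> ('a \<Rightarrow> 'a) \<Rightarrow> 'b metric \<Rightarrow> ('b \<Rightarrow> 'b) \<Rightarrow> bool" where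
  "quasi_disjoint X T Y S \<longleftrightarrow> minimal_system X T \<and> minimal_system Y S \<and>
     (\<exists>(Xeq :: 'a metric) Tq \<pi>X (Yeq :: 'b metric) Sq \<pi>Y.
        max_eq_factor X T Xeq Tq \<pi>X \<and> max_eq_factor Y S Yeq Sq \<pi>Y \<and>
        (\<forall>J. joining X T Y S J \<and> map_prod \<pi>X \<pi>Y ` J = mspace Xeq \<times> mspace Yeq \<longleftrightarrow>
             J = mspace X \<times> mspace Y))"


section \<open>Strong quasi-disjointness\<close>

definition residual_in :: "'a topology \<Rightarrow> 'a set \<Rightarrow> bool" where
  "residual_in \<T> \<Omega> \<longleftrightarrow> \<Omega> \<subseteq> topspace \<T> \<and>
     (\<exists>\<U>. countable \<U> \<and> (\<forall>U\<in>\<U>. openin \<T> U \<and> \<T> closure_of U = topspace \<T>) \<and>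
          topspace \<T> \<inter> \<Inter>\<U> \<subseteq> \<Omega>)"

text \<open>\<open>G\<close> (written multiplicatively) makes the compact metric space \<open>E\<close> a compact abelian
  group, on which \<open>Q\<close> is the translation by \<open>g\<close>.\<close>

definition group_rotation :: "'e metric \<Rightarrow> ('e \<Rightarrow> 'e) \<Rightarrow> 'e monoid \<Rightarrow> 'e \<Rightarrow> bool" where
  "group_rotation E Q G g \<longleftrightarrow>
     compact_space (mtopology_of E) \<and> comm_group G \<and> carrier G = mspace E \<and>
     continuous_map (prod_topology (mtopology_of E) (mtopology_of E)) (mtopology_of E)
       (\<lambda>(x, y). x \<otimes>\<^bsub>G\<^esub> y) \<and>
     continuous_map (mtopology_of E) (mtopology_of E) (\<lambda>x. inv\<^bsub>G\<^esub> x) \<and>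
     g \<in> carrier G \<and> (\<forall>x\<in>mspace E. Q x = x \<otimes>\<^bsub>G\<^esub> g)"

text \<open>Two choices of \<open>(E, Q, G, g, \<alpha>, \<beta>)\<close> below lead to maps \<open>\<gamma>\<close> that differ by a
  homeomorphism of the targets, so again the choice does not matter.\<close>

definition strongly_quasi_disjoint ::
    "'a metric \<Rightarrow> ('a \<Rightarrow> 'a) \<Rightarrow> 'b metric \<Rightarrow> ('b \<Rightarrow> 'b) \<Rightarrow> bool" where
  "strongly_quasi_disjoint X T Y S \<longleftrightarrow> minimal_system X T \<and> minimal_system Y S \<and>
     (\<exists>(E :: 'a metric) Q G g \<alpha> \<beta>.
        max_common_eq_factor X T Y S E Q \<alpha> \<beta> \<and> group_rotation E Q G g \<and>
        (\<exists>\<Omega>. residual_in (mtopology_of E) \<Omega> \<and>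
           (\<forall>z\<in>\<Omega>. minimal_subset (prod_topology (mtopology_of X) (mtopology_of Y)) (map_prod T S)
                     {(x, y). x \<in> mspace X \<and> y \<in> mspace Y \<and> \<alpha> x \<otimes>\<^bsub>G\<^esub> inv\<^bsub>G\<^esub> (\<beta> y) = z})))"


section \<open>The universal properties for test systems on arbitrary types\<close>

lemma dyn_system_bij: "dyn_system X T \<Longrightarrow> bij_betw T (mspace X) (mspace X)"
  unfolding dyn_system_def bij_betw_def
  by (metis homeomorphic_imp_injective_map homeomorphic_imp_surjective_map topspace_mtopology_of)

lemma ziter_conj:
  assumes T: "bij_betw T A A" and s: "inj_on s A"
    and P: "\<And>x. x \<in> A \<Longrightarrow> P (s x) = s (T x)" and x: "x \<in> A"
  shows "ziter A T n x \<in> A" "ziter (s ` A) P n (s x) = s (ziter A T n x)"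
proof -
  have P': "bij_betw P (s ` A) (s ` A)"
  proof -
    have "bij_betw (s \<circ> T \<circ> inv_into A s) (s ` A) (s ` A)"
      by (intro bij_betw_trans[OF bij_betw_trans[OF _ T, of "inv_into A s", unfolded comp_assoc]]
             bij_betw_inv_into inj_on_imp_bij_betw s
          | subst comp_assoc)+
    then show ?thesis
      by (rule bij_betw_cong[THEN iffD1, rotated]) (auto simp: P s)
  qed
  have inv: "inv_into A T y \<in> A \<and> inv_into (s ` A) P (s y) = s (inv_into A T y)" if "y \<in> A" for y
  proof -
    have 1: "inv_into A T y \<in> A"
      using T that by (metis bij_betw_imp_surj_on inv_into_into)
    moreover have "P (s (inv_into A T y)) = s y"
      using 1 P T that by (simp add: bij_betw_inv_into_right)
    ultimately show ?thesis
      using P' by (metis bij_betw_inv_into_left image_eqI)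
  qed
  have "(T ^^ k) x \<in> A \<and> (P ^^ k) (s x) = s ((T ^^ k) x)" for k
    using x T P by (induction k) (auto simp: bij_betw_apply)
  moreover have "(inv_into A T ^^ k) x \<in> A \<and>
      (inv_into (s ` A) P ^^ k) (s x) = s ((inv_into A T ^^ k) x)" for k
    using x inv by (induction k) auto
  ultimately show "ziter A T n x \<in> A" "ziter (s ` A) P n (s x) = s (ziter A T n x)"
    by (auto simp: ziter_def)
qed

lemma equicontinuous_system_transport:
  fixes W :: "'w metric" and s :: "'w \<Rightarrow> 'a"
  assumes W: "equicontinuous_system W P" and s: "inj_on s (mspace W)"
  obtains W' P' r where "equicontinuous_system W' P'"
    "factor_map W P W' P' s" "factor_map W' P' W P r" "\<And>w. w \<in> mspace W \<Longrightarrow> r (s w) = w"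
proof
  define r where "r = inv_into (mspace W) s"
  define d where "d u v = mdist W (r u) (r v)" for u v
  define W' where "W' = metric (s ` mspace W, d)"
  define P' where "P' = s \<circ> P \<circ> r"
  have dW: "dyn_system W P"
    using W by (simp add: equicontinuous_system_def)
  have bij: "bij_betw P (mspace W) (mspace W)"
    by (rule dyn_system_bij[OF dW])
  show rs: "r (s w) = w" if "w \<in> mspace W" for w
    using that s by (simp add: r_def)
  interpret W': Metric_space "s ` mspace W" d
    by unfold_locales (auto simp: d_def rs mdist_commute mdist_triangle)
  have msp [simp]: "mspace W' = s ` mspace W" and mdist [simp]: "mdist W' = d"
    by (auto simp: W'_def)
  have P's: "P' (s w) = s (P w)" if "w \<in> mspace W" for w
    using that by (simp add: P'_def rs)
  have cs: "continuous_map (mtopology_of W) (mtopology_of W') s"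
    by (rule Lipschitz_continuous_imp_continuous_map)
      (auto simp: Lipschitz_continuous_map_def d_def rs intro!: exI[of _ 1])
  have cr: "continuous_map (mtopology_of W') (mtopology_of W) r"
    by (rule Lipschitz_continuous_imp_continuous_map)
      (auto simp: Lipschitz_continuous_map_def d_def rs intro!: exI[of _ 1])
  have hs: "homeomorphic_map (mtopology_of W) (mtopology_of W') s"
    and hr: "homeomorphic_map (mtopology_of W') (mtopology_of W) r"
    using cs cr by (auto simp: homeomorphic_map_maps homeomorphic_maps_def rs)
  have "compact_space (mtopology_of W')"
    using dW homeomorphic_map_imp_homeomorphic_space[OF hs] homeomorphic_compact_space
    by (auto simp: dyn_system_def)
  moreover have "homeomorphic_map (mtopology_of W') (mtopology_of W') P'"
    using dW hs hr by (auto simp: dyn_system_def P'_def comp_assoc intro: homeomorphic_map_compose)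
  ultimately have dyn: "dyn_system W' P'"
    by (simp add: dyn_system_def)
  have conj: "ziter (mspace W') P' n (s x) = s (ziter (mspace W) P n x)"
    and cl: "ziter (mspace W) P n x \<in> mspace W" if "x \<in> mspace W" for x n
    unfolding msp
    using ziter_conj(2)[OF bij s, of P', OF P's that] ziter_conj(1)[OF bij s, of P', OF P's that]
    by simp_all
  show "equicontinuous_system W' P'"
    unfolding equicontinuous_system_def
  proof (intro conjI dyn allI impI)
    fix \<epsilon> :: real
    assume "\<epsilon> > 0"
    then obtain \<delta> where "\<delta> > 0" and \<delta>: "\<And>x y n. x \<in> mspace W \<Longrightarrow> y \<in> mspace W \<Longrightarrow>
        mdist W x y < \<delta> \<Longrightarrow> mdist W (ziter (mspace W) P n x) (ziter (mspace W) P n y) < \<epsilon>"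
      using W unfolding equicontinuous_system_def by metis
    have "mdist W' (ziter (mspace W') P' n (s x)) (ziter (mspace W') P' n (s y)) < \<epsilon>"
      if "x \<in> mspace W" "y \<in> mspace W" "mdist W' (s x) (s y) < \<delta>" for x y n
      using \<delta>[OF that(1,2), of n] that(3)
      unfolding conj[OF that(1)] conj[OF that(2)] mdist d_def by (simp only: rs cl that)
    then show "\<exists>\<delta>>0. \<forall>x\<in>mspace W'. \<forall>y\<in>mspace W'. mdist W' x y < \<delta> \<longrightarrow>
        (\<forall>n. mdist W' (ziter (mspace W') P' n x) (ziter (mspace W') P' n y) < \<epsilon>)"
      using \<open>\<delta> > 0\<close> unfolding msp by blast
  qed
  show "factor_map W P W' P' s"
    using cs by (simp add: factor_map_def P's)
  have "P w \<in> mspace W" if "w \<in> mspace W" for w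
    using bij that by (rule bij_betw_apply)
  then show "factor_map W' P' W P r"
    using cr by (auto simp: factor_map_def P's rs image_image)
qed

lemma factor_map_comp:
  assumes p: "factor_map X T Y S p" and q: "factor_map Y S Z R q"
  shows "factor_map X T Z R (\<lambda>x. q (p x))"
proof -
  have "continuous_map (mtopology_of X) (mtopology_of Z) (q \<circ> p)"
    using p q by (auto simp: factor_map_def intro: continuous_map_compose)
  moreover have "(\<lambda>x. q (p x)) ` mspace X = q ` p ` mspace X"
    by auto
  moreover have "p x \<in> mspace Y" if "x \<in> mspace X" for x
    using p that by (auto simp: factor_map_def)
  ultimately show ?thesis
    using p q by (simp add: factor_map_def comp_def)
qed

lemma inj_on_section:
  "factor_map X T W P \<phi> \<Longrightarrow> inj_on (inv_into (mspace X) \<phi>) (mspace W)"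
  unfolding factor_map_def by (intro inj_on_inv_into) simp

lemma max_eq_factor_universal:
  fixes W :: "'w metric"
  assumes E: "max_eq_factor X T E Q p"
    and W: "equicontinuous_system W P" "factor_map X T W P \<phi>"
  shows "\<exists>\<eta>. factor_map E Q W P \<eta> \<and> (\<forall>x\<in>mspace X. \<phi> x = \<eta> (p x))"
proof -
  define s where "s = inv_into (mspace X) \<phi>"
  have "inj_on s (mspace W)"
    unfolding s_def by (rule inj_on_section[OF W(2)])
  then obtain W' P' r where W': "equicontinuous_system W' P'"
      "factor_map W P W' P' s" "factor_map W' P' W P r" "\<And>w. w \<in> mspace W \<Longrightarrow> r (s w) = w"
    by (rule equicontinuous_system_transport[OF W(1)]) simp
  obtain \<eta> where \<eta>: "factor_map E Q W' P' \<eta>" "\<forall>x\<in>mspace X. s (\<phi> x) = \<eta> (p x)"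
    using E W'(1) factor_map_comp[OF W(2) W'(2)] unfolding max_eq_factor_def by metis
  have "\<phi> x \<in> mspace W" if "x \<in> mspace X" for x
    using W(2) that by (auto simp: factor_map_def)
  then show ?thesis
    using factor_map_comp[OF \<eta>(1) W'(3)] \<eta>(2) W'(4) by metis
qed

lemma max_common_eq_factor_universal:
  fixes W :: "'w metric"
  assumes E: "max_common_eq_factor X T Y S E Q \<alpha> \<beta>"
    and W: "equicontinuous_system W P" "factor_map X T W P \<phi>" "factor_map Y S W P \<psi>"
  shows "\<exists>\<eta>1 \<eta>2. factor_map E Q W P \<eta>1 \<and> factor_map E Q W P \<eta>2 \<and>
    (\<forall>x\<in>mspace X. \<phi> x = \<eta>1 (\<alpha> x)) \<and> (\<forall>y\<in>mspace Y. \<psi> y = \<eta>2 (\<beta> y))"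
proof -
  define s where "s = inv_into (mspace X) \<phi>"
  have "inj_on s (mspace W)"
    unfolding s_def by (rule inj_on_section[OF W(2)])
  then obtain W' P' r where W': "equicontinuous_system W' P'"
      "factor_map W P W' P' s" "factor_map W' P' W P r" "\<And>w. w \<in> mspace W \<Longrightarrow> r (s w) = w"
    by (rule equicontinuous_system_transport[OF W(1)]) simp
  obtain \<eta>1 \<eta>2 where \<eta>: "factor_map E Q W' P' \<eta>1" "factor_map E Q W' P' \<eta>2"
      "\<forall>x\<in>mspace X. s (\<phi> x) = \<eta>1 (\<alpha> x)" "\<forall>y\<in>mspace Y. s (\<psi> y) = \<eta>2 (\<beta> y)"
    using E[unfolded max_common_eq_factor_def, THEN conjunct2, THEN conjunct2, THEN conjunct2,
        rule_format, OF conjI[OF W'(1) conjI[OF factor_map_comp[OF W(2) W'(2)]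
          factor_map_comp[OF W(3) W'(2)]]]]
    by (elim exE conjE) (rule that)
  show ?thesis
  proof (intro exI conjI ballI)
    show "factor_map E Q W P (\<lambda>e. r (\<eta>1 e))" "factor_map E Q W P (\<lambda>e. r (\<eta>2 e))"
      by (rule factor_map_comp[OF \<eta>(1) W'(3)] factor_map_comp[OF \<eta>(2) W'(3)])+
    show "\<phi> x = r (\<eta>1 (\<alpha> x))" if "x \<in> mspace X" for x
    proof -
      have "\<phi> x \<in> mspace W"
        using W(2) that by (auto simp: factor_map_def)
      then show ?thesis
        using W'(4) that by (simp flip: \<eta>(3)[rule_format, OF that])
    qed
    show "\<psi> y = r (\<eta>2 (\<beta> y))" if "y \<in> mspace Y" for y
    proof -
      have "\<psi> y \<in> mspace W"
        using W(3) that by (auto simp: factor_map_def)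
      then show ?thesis
        using W'(4) that by (simp flip: \<eta>(4)[rule_format, OF that])
    qed
  qed
qed

end

theory Submission
  imports Defs
begin

text \<open>Let \<open>a : X \<rightarrow> K\<close> be a factor map onto an equicontinuous system, metrized so that its
  homeomorphism is an isometry (\<open>K\<close> is \<open>X\<^sub>e\<^sub>q\<close> in part (1) and \<open>Eq(X, Y)\<close> in part (2)). Declare the
  distance of two points of \<open>Z\<close> to be the least distance of \<open>a x\<close> and \<open>a x'\<close> over the points
  \<open>x\<close>, \<open>x'\<close> above them. Minimality of \<open>X\<close> shows that the minimum is attained from every \<open>x\<close>
  in the fibre, so this is an invariant pseudometric, and the metric quotient \<open>Z'\<close> is the
  equicontinuous factor of \<open>Z\<close> required by the definitions. The induced map \<open>q : K \<rightarrow> Z'\<close> is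
  open, and whenever \<open>q u\<close> is the image of \<open>z\<close> there is a point of \<open>X\<close> above both \<open>u\<close> and \<open>z\<close>.
  This lifting property turns joinings of \<open>Z\<close> and \<open>Y\<close> into joinings of \<open>X\<close> and \<open>Y\<close> with full
  image, and shows that the fibre of \<open>Z \<times> Y \<rightarrow> Z'\<close> over \<open>q e\<close> is the image of the fibre of
  \<open>X \<times> Y \<rightarrow> K\<close> over \<open>e\<close>, hence minimal when the latter is. As \<open>q\<close> is open, it maps residual
  sets to residual sets.\<close>

section \<open>Orbits and factor maps\<close>

lemma ziter_0 [simp]: "ziter A f 0 x = x"
  by (simp add: ziter_def)

lemma inv_into_bij_betw_in: "bij_betw f A A \<Longrightarrow> x \<in> A \<Longrightarrow> inv_into A f x \<in> A"
  by (simp add: bij_betw_def inv_into_into)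

lemma funpow_in:
  assumes "\<And>x. x \<in> A \<Longrightarrow> f x \<in> A" "x \<in> A"
  shows "(f ^^ k) x \<in> A"
  using assms by (induction k) auto

lemma ziter_in:
  assumes f: "bij_betw f A A" and x: "x \<in> A"
  shows "ziter A f n x \<in> A"
  unfolding ziter_def
  using bij_betw_apply[OF f] inv_into_bij_betw_in[OF f] x by (simp add: funpow_in)

lemma funpow_equivariant:
  assumes "\<And>x. x \<in> A \<Longrightarrow> f x \<in> A" "\<And>x. x \<in> A \<Longrightarrow> p (f x) = g (p x)" "x \<in> A"
  shows "p ((f ^^ k) x) = (g ^^ k) (p x)"
  by (induction k) (simp_all add: assms funpow_in[of A f])

text \<open>Negative iterates are powers of \<open>inv_into\<close>, so the intertwining relation
  has to be carried over to the inverses first. Both maps are bijections of their carriers, hence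
  \<open>p (inv_into A f y)\<close> is the only point of \<open>B\<close> that \<open>g\<close>
  sends to \<open>p y\<close>.\<close>

lemma ziter_equivariant:
  assumes f: "bij_betw f A A" and g: "bij_betw g B B" and p: "p ` A \<subseteq> B"
    and fg: "\<And>x. x \<in> A \<Longrightarrow> p (f x) = g (p x)" and x: "x \<in> A"
  shows "p (ziter A f n x) = ziter B g n (p x)"
proof -
  have "p (inv_into A f y) = inv_into B g (p y)" if y: "y \<in> A" for y
  proof -
    have iy: "inv_into A f y \<in> A"
      by (rule inv_into_bij_betw_in[OF f y])
    then have "g (p (inv_into A f y)) = p y"
      using fg[OF iy] bij_betw_inv_into_right[OF f y] by simp
    moreover have "p (inv_into A f y) \<in> B"
      using iy p by blast
    ultimately show ?thesis
      using bij_betw_inv_into_left[OF g] by metis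
  qed
  then show ?thesis
    unfolding ziter_def
    using funpow_equivariant[of A f p g, OF bij_betw_apply[OF f] fg x]
      funpow_equivariant[of A "inv_into A f" p "inv_into B g", OF inv_into_bij_betw_in[OF f] _ x]
    by simp
qed

lemma ziter_add1:
  assumes f: "bij_betw f A A" and x: "x \<in> A"
  shows "ziter A f (n + 1) x = f (ziter A f n x)"
proof (cases "n \<ge> 0")
  case True
  then show ?thesis
    by (simp add: ziter_def nat_add_distrib)
next
  case False
  then obtain k where n: "n = - int (Suc k)"
    using negD[of n] by auto
  have "(inv_into A f ^^ k) x \<in> A"
    using x by (induction k) (simp_all add: bij_betw_imp_surj_on[OF f] inv_into_into)
  moreover have "nat (- (n + 1)) = k" "nat (- n) = Suc k"
    using n by auto
  \<comment> \<open>The case \<open>k = 0\<close> is the step from exponent -1 to 0, where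
    \<open>ziter\<close> changes from inverse to forward powers.\<close>
  ultimately show ?thesis
    using bij_betw_inv_into_right[OF f] n by (cases k) (simp_all add: ziter_def)
qed

lemma ziter_shift:
  assumes f: "bij_betw f A A" and x: "x \<in> A"
  shows "ziter A f n (f x) = f (ziter A f n x)"
  by (rule ziter_equivariant[OF f f _ _ x, symmetric]) (use f in \<open>auto simp: bij_betw_def\<close>)

text \<open>Here \<open>d\<close> is any function of two variables. Besides metrics it is
  instantiated with \<open>\<lambda>u v. f v\<close>, which turns the lemma into the constancy of an
  invariant real function along an orbit.\<close>

lemma ziter_isometry:
  assumes f: "bij_betw f A A" and iso: "\<And>u v. u \<in> A \<Longrightarrow> v \<in> A \<Longrightarrow> d (f u) (f v) = d u v"
    and u: "u \<in> A" and v: "v \<in> A"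
  shows "d (ziter A f n u) (ziter A f n v) = d u v"
proof -
  have f': "f x \<in> A" if "x \<in> A" for x
    using f that by (rule bij_betw_apply)
  note inv = inv_into_bij_betw_in[OF f]
  have iso': "d (inv_into A f u) (inv_into A f v) = d u v" if "u \<in> A" "v \<in> A" for u v
    using iso[OF inv[OF that(1)] inv[OF that(2)]] that by (simp add: bij_betw_inv_into_right[OF f])
  have "d ((f ^^ k) u) ((f ^^ k) v) = d u v" for k
    by (induction k) (simp_all add: iso f' funpow_in[of A f] u v)
  moreover have "d ((inv_into A f ^^ k) u) ((inv_into A f ^^ k) v) = d u v" for k
    by (induction k) (simp_all add: iso' inv funpow_in[of A "inv_into A f"] u v)
  ultimately show ?thesis
    by (simp add: ziter_def)
qed

section \<open>Topologies of metrics and the density of orbits\<close>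

lemma Hausdorff_space_mtopology_of [simp]: "Hausdorff_space (mtopology_of m)"
  by (simp add: mtopology_of_def Metric_space.Hausdorff_space_mtopology)

lemma continuous_map_mtopology_of_iff:
  "continuous_map (mtopology_of M) (mtopology_of N) f \<longleftrightarrow> f ` mspace M \<subseteq> mspace N \<and>
    (\<forall>a\<in>mspace M. \<forall>\<epsilon>>0. \<exists>\<delta>>0. \<forall>x. x \<in> mspace M \<and> mdist M a x < \<delta> \<longrightarrow> mdist N (f a) (f x) < \<epsilon>)"
  unfolding mtopology_of_def by (rule Metric_space.metric_continuous_map) auto

text \<open>The working form of minimality: a closed condition is verified along a single orbit and
  then holds on the whole system.\<close>

lemma minimal_orbit_closed:
  assumes X: "minimal_system X T" and x: "x \<in> mspace X" and C: "closedin (mtopology_of X) C"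
    and orb: "\<And>n. ziter (mspace X) T n x \<in> C"
  shows "C = mspace X"
proof -
  have "mtopology_of X closure_of zorbit (mspace X) T x \<subseteq> C"
    using orb by (intro closure_of_minimal[OF _ C]) (auto simp: zorbit_def)
  then show ?thesis
    using X x closedin_subset[OF C] by (simp add: minimal_system_def)
qed

text \<open>The level set of \<open>f\<close> through \<open>y\<close> is closed and contains the
  orbit of \<open>y\<close>.\<close>

lemma minimal_invariant_const:
  assumes X: "minimal_system X T" and f: "continuous_map (mtopology_of X) euclideanreal f"
    and inv: "\<And>x. x \<in> mspace X \<Longrightarrow> f (T x) = f x" and x: "x \<in> mspace X" and y: "y \<in> mspace X"
  shows "f x = f y"
proof -
  have bij: "bij_betw T (mspace X) (mspace X)"
    using X dyn_system_bij by (auto simp: minimal_system_def)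
  have "{z \<in> mspace X. f z = f y} = mspace X"
  proof (rule minimal_orbit_closed[OF X y])
    show "closedin (mtopology_of X) {z \<in> mspace X. f z = f y}"
      using closedin_continuous_map_preimage[OF f, of "{f y}"] by simp
    show "ziter (mspace X) T n y \<in> {z \<in> mspace X. f z = f y}" for n
      using ziter_in[OF bij y, of n]
        ziter_isometry[OF bij, of "\<lambda>u v. f v", OF inv y y, of n] by simp
  qed
  then show ?thesis
    using x by auto
qed

section \<open>Factor maps\<close>

lemma factor_map_in: "factor_map X T Y S p \<Longrightarrow> x \<in> mspace X \<Longrightarrow> p x \<in> mspace Y"
  by (auto simp: factor_map_def)

lemma factor_map_continuous:
  "factor_map X T Y S p \<Longrightarrow> continuous_map (mtopology_of X) (mtopology_of Y) p"
  by (simp add: factor_map_def)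

lemma factor_map_surj:
  assumes "factor_map X T Y S p" "y \<in> mspace Y"
  obtains x where "x \<in> mspace X" "p x = y"
proof -
  have "y \<in> p ` mspace X"
    using assms by (simp add: factor_map_def)
  then show ?thesis
    using that by blast
qed

lemma factor_map_ziter:
  assumes "dyn_system X T" "dyn_system Y S" "factor_map X T Y S p" "x \<in> mspace X"
  shows "p (ziter (mspace X) T n x) = ziter (mspace Y) S n (p x)"
  using assms(3) by (intro ziter_equivariant dyn_system_bij assms) (auto simp: factor_map_def)

text \<open>A continuous surjection from a compact space onto a Hausdorff space is a quotient map.
  This allows continuity of a map on \<open>Y\<close> to be tested after composition with
  \<open>p\<close>.\<close>

lemma factor_map_quotient_map:
  assumes "dyn_system X T" "factor_map X T Y S p"
  shows "quotient_map (mtopology_of X) (mtopology_of Y) p"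
  using assms by (intro continuous_imp_quotient_map) (auto simp: dyn_system_def factor_map_def)

text \<open>The descended map is written down with a set-theoretic section of \<open>p\<close>,
  which need not be continuous. Constancy on the fibres makes its composition with \<open>p\<close>
  equal to \<open>\<phi>\<close>, and continuity then comes from the quotient topology.\<close>

lemma factor_map_descend:
  assumes X: "dyn_system X T" and p: "factor_map X T Y S p" and \<phi>: "factor_map X T W P \<phi>"
    and fib: "\<And>x x'. \<lbrakk>x \<in> mspace X; x' \<in> mspace X; p x = p x'\<rbrakk> \<Longrightarrow> \<phi> x = \<phi> x'"
  obtains \<eta> where "factor_map Y S W P \<eta>" "\<And>x. x \<in> mspace X \<Longrightarrow> \<phi> x = \<eta> (p x)"
proof
  define \<eta> where "\<eta> = \<phi> \<circ> inv_into (mspace X) p"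
  show \<eta>: "\<phi> x = \<eta> (p x)" if "x \<in> mspace X" for x
  proof -
    have "p x \<in> p ` mspace X"
      using that by blast
    then have "inv_into (mspace X) p (p x) \<in> mspace X" "p (inv_into (mspace X) p (p x)) = p x"
      by (simp_all add: inv_into_into f_inv_into_f)
    then show ?thesis
      unfolding \<eta>_def o_def using fib[OF that] by simp
  qed
  have T: "T x \<in> mspace X" if "x \<in> mspace X" for x
    using dyn_system_bij[OF X] that by (rule bij_betw_apply)
  have "continuous_map (mtopology_of X) (mtopology_of W) (\<eta> \<circ> p)"
  proof (rule continuous_map_eq)
    show "continuous_map (mtopology_of X) (mtopology_of W) \<phi>"
      using \<phi> by (simp add: factor_map_def)
  qed (simp add: \<eta>)
  then have "continuous_map (mtopology_of Y) (mtopology_of W) \<eta>"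
    by (rule continuous_compose_quotient_map[OF factor_map_quotient_map[OF X p]])
  moreover have "\<eta> ` mspace Y = mspace W"
  proof -
    have "\<eta> ` p ` mspace X = \<phi> ` mspace X"
      unfolding image_image using \<eta> by (intro image_cong refl) simp
    then show ?thesis
      using p \<phi> by (simp add: factor_map_def)
  qed
  moreover have "\<eta> (S y) = P (\<eta> y)" if "y \<in> mspace Y" for y
  proof -
    obtain x where x: "x \<in> mspace X" "p x = y"
      using factor_map_surj[OF p \<open>y \<in> mspace Y\<close>] .
    have "p (T x) = S y" "\<phi> (T x) = P (\<phi> x)"
      using p \<phi> x by (simp_all add: factor_map_def)
    then show ?thesis
      using \<eta>[OF T[OF x(1)]] \<eta>[OF x(1)] unfolding x(2) by metis
  qed
  ultimately show "factor_map Y S W P \<eta>"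
    by (simp add: factor_map_def)
qed

text \<open>The image of a dense orbit is an orbit, and a continuous map sends the closure of a set
  into the closure of its image.\<close>

lemma minimal_system_factor:
  assumes X: "minimal_system X T" and Y: "dyn_system Y S" and p: "factor_map X T Y S p"
  shows "minimal_system Y S"
proof -
  have dX: "dyn_system X T" and ne: "mspace X \<noteq> {}"
    using X by (auto simp: minimal_system_def)
  have "mtopology_of Y closure_of zorbit (mspace Y) S y = mspace Y" if "y \<in> mspace Y" for y
  proof -
    obtain x where x: "x \<in> mspace X" "p x = y"
      using factor_map_surj[OF p \<open>y \<in> mspace Y\<close>] .
    have "p ` (mtopology_of X closure_of zorbit (mspace X) T x)
        \<subseteq> mtopology_of Y closure_of (p ` zorbit (mspace X) T x)"
      using p by (intro continuous_map_image_closure_subset) (simp add: factor_map_def)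
    moreover have "p ` zorbit (mspace X) T x = zorbit (mspace Y) S y"
      using factor_map_ziter[OF dX Y p x(1)] x(2) by (simp add: zorbit_def image_image)
    ultimately have "mspace Y \<subseteq> mtopology_of Y closure_of zorbit (mspace Y) S y"
      using X x(1) p by (simp add: minimal_system_def factor_map_def)
    then show ?thesis
      using closure_of_subset_topspace[of "mtopology_of Y" "zorbit (mspace Y) S y"] by auto
  qed
  then show ?thesis
    using Y ne p by (auto simp: minimal_system_def factor_map_def)
qed

section \<open>Equicontinuity and invariant metrics\<close>

lemma equicontinuous_system_isometric:
  assumes K: "dyn_system K Q"
    and iso: "\<And>u v. u \<in> mspace K \<Longrightarrow> v \<in> mspace K \<Longrightarrow> mdist K (Q u) (Q v) = mdist K u v"
  shows "equicontinuous_system K Q"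
  unfolding equicontinuous_system_def
proof (intro conjI K allI impI)
  fix \<epsilon> :: real
  assume "\<epsilon> > 0"
  then show "\<exists>\<delta>>0. \<forall>x\<in>mspace K. \<forall>y\<in>mspace K. mdist K x y < \<delta> \<longrightarrow>
      (\<forall>n. mdist K (ziter (mspace K) Q n x) (ziter (mspace K) Q n y) < \<epsilon>)"
    using ziter_isometry[OF dyn_system_bij[OF K], of "mdist K", OF iso]
    by (intro exI[of _ \<epsilon>]) simp
qed

text \<open>The supremum of the distances along two orbits is an invariant metric; equicontinuity
  says exactly that it induces the original topology.\<close>

lemma equicontinuous_invariant_metric:
  assumes E: "equicontinuous_system K Q"
  obtains K' where "mspace K' = mspace K" "mtopology_of K' = mtopology_of K"
    "\<And>u v. u \<in> mspace K \<Longrightarrow> v \<in> mspace K \<Longrightarrow> mdist K' (Q u) (Q v) = mdist K' u v"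
proof
  define I where "I = ziter (mspace K) Q"
  define d where "d u v = (SUP n. mdist K (I n u) (I n v))" for u v
  have dK: "dyn_system K Q"
    using E by (simp add: equicontinuous_system_def)
  have bij: "bij_betw Q (mspace K) (mspace K)"
    by (rule dyn_system_bij[OF dK])
  have I: "I n u \<in> mspace K" if "u \<in> mspace K" for n u
    unfolding I_def by (rule ziter_in[OF bij that])
  \<comment> \<open>Compactness bounds \<open>mdist K\<close> on the carrier, so that the suprema
    defining \<open>d\<close> are finite there.\<close>
  have "compactin (prod_topology (mtopology_of K) (mtopology_of K)) (mspace K \<times> mspace K)"
    using dK by (simp add: dyn_system_def compact_space_def compactin_Times)
  then have "compactin euclidean ((\<lambda>(x, y). mdist K x y) ` (mspace K \<times> mspace K))"
    by (rule image_compactin[OF _ continuous_map_metric])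
  then have "bounded ((\<lambda>(x, y). mdist K x y) ` (mspace K \<times> mspace K))"
    by (simp add: compact_imp_bounded)
  then obtain B where "\<forall>r \<in> (\<lambda>(x, y). mdist K x y) ` (mspace K \<times> mspace K). norm r \<le> B"
    unfolding bounded_iff by blast
  then have B: "mdist K u v \<le> B" if "u \<in> mspace K" "v \<in> mspace K" for u v
    using that by fastforce
  have bdd: "bdd_above (range (\<lambda>n. mdist K (I n u) (I n v)))" if "u \<in> mspace K" "v \<in> mspace K" for u v
    using B I that by (intro bdd_aboveI[where M=B]) auto
  have ge: "mdist K (I n u) (I n v) \<le> d u v" if "u \<in> mspace K" "v \<in> mspace K" for u v n
    unfolding d_def by (rule cSUP_upper[OF UNIV_I bdd[OF that]])
  have ge0: "mdist K u v \<le> d u v" if "u \<in> mspace K" "v \<in> mspace K" for u v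
    using ge[OF that, of 0] by (simp add: I_def)
  have le: "d u v \<le> c" if "\<And>n. mdist K (I n u) (I n v) \<le> c" for u v c
    unfolding d_def using that by (intro cSUP_least) auto
  have nonneg: "0 \<le> d u v" if "u \<in> mspace K" "v \<in> mspace K" for u v
    using ge0[OF that] mdist_nonneg[of K u v] by linarith
  \<comment> \<open>\<open>Metric_space\<close> demands nonnegativity for all elements of the type,
    while the supremum is controlled only on the carrier; the value 0 is put elsewhere.\<close>
  have sub: "Metric_space (mspace K) (\<lambda>u v. if u \<in> mspace K \<and> v \<in> mspace K then d u v else 0)"
  proof
    fix x y z
    show "0 \<le> (if x \<in> mspace K \<and> y \<in> mspace K then d x y else 0)"
      using nonneg by auto
    show "(if x \<in> mspace K \<and> y \<in> mspace K then d x y else 0)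
        = (if y \<in> mspace K \<and> x \<in> mspace K then d y x else 0)"
      by (simp add: d_def mdist_commute)
    assume xy: "x \<in> mspace K" "y \<in> mspace K"
    have "d x y = 0 \<longleftrightarrow> x = y"
    proof
      assume "d x y = 0"
      then show "x = y"
        using ge0[OF xy] mdist_zero[OF xy] mdist_nonneg[of K x y] by simp
    next
      assume "x = y"
      then have "mdist K (I n x) (I n y) = 0" for n
        using mdist_zero[OF I[OF xy(1)] I[OF xy(2)], of n n] by simp
      then show "d x y = 0"
        by (simp add: d_def)
    qed
    then show "((if x \<in> mspace K \<and> y \<in> mspace K then d x y else 0) = 0) = (x = y)"
      using xy by simp
    assume z: "z \<in> mspace K"
    have "d x z \<le> d x y + d y z"
    proof (rule le)
      fix n
      have "mdist K (I n x) (I n z) \<le> mdist K (I n x) (I n y) + mdist K (I n y) (I n z)"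
        using I xy z by (intro mdist_triangle) auto
      then show "mdist K (I n x) (I n z) \<le> d x y + d y z"
        using ge[OF xy, of n] ge[OF xy(2) z, of n] by linarith
    qed
    then show "(if x \<in> mspace K \<and> z \<in> mspace K then d x z else 0)
        \<le> (if x \<in> mspace K \<and> y \<in> mspace K then d x y else 0)
        + (if y \<in> mspace K \<and> z \<in> mspace K then d y z else 0)"
      using xy z by simp
  qed
  define K' where "K' = metric (mspace K, \<lambda>u v. if u \<in> mspace K \<and> v \<in> mspace K then d u v else 0)"
  show sp: "mspace K' = mspace K"
    unfolding K'_def by (rule Metric_space.mspace_metric[OF sub])
  have dist: "mdist K' u v = d u v" if "u \<in> mspace K" "v \<in> mspace K" for u v
    unfolding K'_def Metric_space.mdist_metric[OF sub] using that by simp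
  have "continuous_map (mtopology_of K) (mtopology_of K') id"
    unfolding continuous_map_mtopology_of_iff
  proof (intro conjI ballI allI impI)
    fix a and \<epsilon> :: real
    assume a: "a \<in> mspace K" and "\<epsilon> > 0"
    \<comment> \<open>Half of \<open>\<epsilon>\<close> is used because a supremum of values below a
      bound is only at most that bound.\<close>
    then obtain \<delta> where "\<delta> > 0" and \<delta>: "\<And>x y n. x \<in> mspace K \<Longrightarrow> y \<in> mspace K \<Longrightarrow>
        mdist K x y < \<delta> \<Longrightarrow> mdist K (I n x) (I n y) < \<epsilon> / 2"
      using E unfolding equicontinuous_system_def I_def by (metis half_gt_zero)
    have "d a x \<le> \<epsilon> / 2" if "x \<in> mspace K" "mdist K a x < \<delta>" for x
      using \<delta>[OF a that] by (intro le) (simp add: less_imp_le)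
    then show "\<exists>\<delta>>0. \<forall>x. x \<in> mspace K \<and> mdist K a x < \<delta> \<longrightarrow> mdist K' (id a) (id x) < \<epsilon>"
      using \<open>\<delta> > 0\<close> \<open>\<epsilon> > 0\<close> a by (intro exI[of _ \<delta>]) (force simp: dist)
  qed (simp add: sp)
  moreover have "continuous_map (mtopology_of K') (mtopology_of K) id"
    unfolding continuous_map_mtopology_of_iff sp
  proof (intro conjI ballI allI impI)
    fix a and \<epsilon> :: real
    assume a: "a \<in> mspace K" and "\<epsilon> > 0"
    then show "\<exists>\<delta>>0. \<forall>x. x \<in> mspace K \<and> mdist K' a x < \<delta> \<longrightarrow> mdist K (id a) (id x) < \<epsilon>"
      using ge0[OF a] by (intro exI[of _ \<epsilon>]) (force simp: dist)
  qed simp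
  ultimately have "openin (mtopology_of K') U \<longleftrightarrow> openin (mtopology_of K) U" for U
    using topology_finer_continuous_id[of "mtopology_of K'" "mtopology_of K"]
      topology_finer_continuous_id[of "mtopology_of K" "mtopology_of K'"] sp
    by (auto simp: openin_subset)
  then show "mtopology_of K' = mtopology_of K"
    by (simp add: topology_eq)
  show "mdist K' (Q u) (Q v) = mdist K' u v" if "u \<in> mspace K" "v \<in> mspace K" for u v
  proof -
    have Q: "Q w \<in> mspace K" if "w \<in> mspace K" for w
      using bij that by (rule bij_betw_apply)
    \<comment> \<open>Replacing \<open>u\<close> and \<open>v\<close> by their images under
      \<open>Q\<close> merely shifts the index of the supremum by one, which yields both
      inequalities.\<close>
    have shift: "I (n + 1) w = I n (Q w)" if "w \<in> mspace K" for n w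
      using ziter_add1[OF bij that] ziter_shift[OF bij that] by (simp add: I_def)
    have "d (Q u) (Q v) \<le> d u v"
      using ge[OF that] by (intro le) (simp flip: shift add: that)
    moreover have "d u v \<le> d (Q u) (Q v)"
    proof (rule le)
      show "mdist K (I n u) (I n v) \<le> d (Q u) (Q v)" for n
        using ge[OF Q Q, OF that, of "n - 1"] shift[OF that(1), of "n - 1"]
          shift[OF that(2), of "n - 1"] by simp
    qed
    ultimately show ?thesis
      using that by (simp add: dist Q)
  qed
qed

section \<open>The common quotient of two factors, one of which is isometric\<close>

lemma compact_space_attains_inf:
  assumes "compact_space X" "closedin X F" "F \<noteq> {}" and f: "continuous_map X euclideanreal f"
  obtains x where "x \<in> F" "\<And>y. y \<in> F \<Longrightarrow> f x \<le> f y"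
proof -
  have "compactin euclidean (f ` F)"
    using assms closedin_compact_space image_compactin by blast
  then have "compact (f ` F)"
    by simp
  then obtain s where "s \<in> f ` F" "\<forall>t\<in>f ` F. s \<le> t"
    using compact_attains_inf[of "f ` F"] \<open>F \<noteq> {}\<close> by blast
  then show ?thesis
    using that by blast
qed

text \<open>In both applications \<open>K\<close> is the given equicontinuous factor of
  \<open>X\<close> with its metric replaced by an invariant one inducing the same topology.\<close>

locale isometric_factor_pair =
  fixes X :: "'a metric" and T and K :: "'k metric" and Q and a
    and Z :: "'c metric" and R and p
  assumes minX: "minimal_system X T"
    and dynK: "dyn_system K Q"
    and iso: "\<And>u v. u \<in> mspace K \<Longrightarrow> v \<in> mspace K \<Longrightarrow> mdist K (Q u) (Q v) = mdist K u v"
    and fa: "factor_map X T K Q a"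
    and dynZ: "dyn_system Z R"
    and fp: "factor_map X T Z R p"
begin

lemma dynX: "dyn_system X T"
  using minX by (simp add: minimal_system_def)

lemma compact_X: "compact_space (mtopology_of X)"
  using dynX by (simp add: dyn_system_def)

lemma T_in: "x \<in> mspace X \<Longrightarrow> T x \<in> mspace X"
  using dyn_system_bij[OF dynX] by (rule bij_betw_apply)

lemma a_in: "x \<in> mspace X \<Longrightarrow> a x \<in> mspace K"
  by (rule factor_map_in[OF fa])

lemma p_in: "x \<in> mspace X \<Longrightarrow> p x \<in> mspace Z"
  by (rule factor_map_in[OF fp])

lemma a_T: "x \<in> mspace X \<Longrightarrow> a (T x) = Q (a x)"
  using fa by (simp add: factor_map_def)

lemma p_T: "x \<in> mspace X \<Longrightarrow> p (T x) = R (p x)"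
  using fp by (simp add: factor_map_def)

lemma cont_a: "continuous_map (mtopology_of X) (mtopology_of K) a"
  using fa by (simp add: factor_map_def)

lemma cont_p: "continuous_map (mtopology_of X) (mtopology_of Z) p"
  using fp by (simp add: factor_map_def)

text \<open>The distance that the \<open>n\<close>-th iterate moves a point of \<open>K\<close> is
  continuous, and it is invariant because \<open>Q\<close> is an isometry commuting with its
  iterates. Pulled back to the minimal system \<open>X\<close> it is therefore constant.\<close>

lemma displacement_const:
  assumes "x \<in> mspace X" "y \<in> mspace X"
  shows "mdist K (a x) (a (ziter (mspace X) T n x)) = mdist K (a y) (a (ziter (mspace X) T n y))"
proof -
  define F where "F x = mdist K (a x) (ziter (mspace K) Q n (a x))" for x
  have bij: "bij_betw Q (mspace K) (mspace K)"
    by (rule dyn_system_bij[OF dynK])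
  have Fx: "F x = mdist K (a x) (a (ziter (mspace X) T n x))" if "x \<in> mspace X" for x
    unfolding F_def by (simp add: factor_map_ziter[OF dynX dynK fa that])
  have "continuous_map (mtopology_of K) (mtopology_of K) (ziter (mspace K) Q n)"
    unfolding continuous_map_mtopology_of_iff
  proof (intro conjI ballI allI impI)
    show "ziter (mspace K) Q n ` mspace K \<subseteq> mspace K"
      using ziter_in[OF bij] by blast
    fix u and \<epsilon> :: real
    assume "u \<in> mspace K" "\<epsilon> > 0"
    then show "\<exists>\<delta>>0. \<forall>x. x \<in> mspace K \<and> mdist K u x < \<delta> \<longrightarrow>
        mdist K (ziter (mspace K) Q n u) (ziter (mspace K) Q n x) < \<epsilon>"
      using ziter_isometry[OF bij, of "mdist K", OF iso] by (intro exI[of _ \<epsilon>]) simp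
  qed
  then have "continuous_map (mtopology_of X) (mtopology_of K) (\<lambda>x. ziter (mspace K) Q n (a x))"
    using continuous_map_compose[OF cont_a] by (simp add: o_def)
  then have "continuous_map (mtopology_of X) euclideanreal F"
    unfolding F_def by (intro continuous_map_mdist cont_a)
  moreover have "F (T x) = F x" if "x \<in> mspace X" for x
    unfolding F_def a_T[OF that] ziter_shift[OF bij a_in[OF that]]
    by (rule iso[OF a_in[OF that] ziter_in[OF bij a_in[OF that]]])
  ultimately have "F x = F y"
    by (rule minimal_invariant_const[OF minX _ _ assms])
  then show ?thesis
    using Fx assms by simp
qed

text \<open>The set of pairs \<open>(u, v)\<close> with the same image in \<open>Z\<close> and equal distances to \<open>x1\<close>
  and \<open>x2\<close> contains the orbit of \<open>(x1, x2)\<close>, because displacements are constant; hence its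
  closed first projection is everything.\<close>

lemma fibre_transfer:
  assumes x1: "x1 \<in> mspace X" and x2: "x2 \<in> mspace X" and eq: "p x1 = p x2"
    and y: "y \<in> mspace X"
  obtains y' where "y' \<in> mspace X" "p y' = p y" "mdist K (a x2) (a y') = mdist K (a x1) (a y)"
proof -
  let ?XX = "prod_topology (mtopology_of X) (mtopology_of X)"
  define C where "C = {w \<in> topspace ?XX. p (fst w) = p (snd w)} \<inter>
      {w \<in> topspace ?XX. mdist K (a x2) (a (snd w)) = mdist K (a x1) (a (fst w))}"
  have fst: "continuous_map ?XX (mtopology_of X) fst" and snd: "continuous_map ?XX (mtopology_of X) snd"
    by (simp_all add: continuous_map_fst continuous_map_snd)
  have "closedin ?XX {w \<in> topspace ?XX. p (fst w) = p (snd w)}"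
    using continuous_map_compose[OF fst cont_p] continuous_map_compose[OF snd cont_p]
    by (intro closedin_continuous_maps_eq[OF Hausdorff_space_mtopology_of]) (simp_all add: o_def)
  moreover have "closedin ?XX {w \<in> topspace ?XX. mdist K (a x2) (a (snd w)) = mdist K (a x1) (a (fst w))}"
  proof (rule closedin_continuous_maps_eq[where Y=euclideanreal])
    show "continuous_map ?XX euclideanreal (\<lambda>w. mdist K (a x2) (a (snd w)))"
      using continuous_map_compose[OF snd cont_a] a_in[OF x2]
      by (intro continuous_map_mdist) (simp_all add: o_def)
    show "continuous_map ?XX euclideanreal (\<lambda>w. mdist K (a x1) (a (fst w)))"
      using continuous_map_compose[OF fst cont_a] a_in[OF x1]
      by (intro continuous_map_mdist) (simp_all add: o_def)
  qed simp
  ultimately have "closedin ?XX C"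
    unfolding C_def by (rule closedin_Int)
  moreover have "closed_map ?XX (mtopology_of X) fst"
    using compact_X by (intro continuous_imp_closed_map fst) (simp_all add: compact_space_prod_topology)
  ultimately have "closedin (mtopology_of X) (fst ` C)"
    by (simp add: closed_map_def)
  moreover have "ziter (mspace X) T n x1 \<in> fst ` C" for n
  proof -
    have "p (ziter (mspace X) T n x1) = p (ziter (mspace X) T n x2)"
      using factor_map_ziter[OF dynX dynZ fp] x1 x2 eq by simp
    then have "(ziter (mspace X) T n x1, ziter (mspace X) T n x2) \<in> C"
      using displacement_const[OF x2 x1, of n] ziter_in[OF dyn_system_bij[OF dynX]] x1 x2
      by (simp add: C_def)
    then show ?thesis
      by (metis fst_conv imageI)
  qed
  ultimately have "fst ` C = mspace X"
    by (rule minimal_orbit_closed[OF minX x1])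
  then have "y \<in> fst ` C"
    using y by simp
  then obtain w where w: "w \<in> C" "y = fst w"
    by (rule imageE)
  show ?thesis
  proof (rule that)
    show "snd w \<in> mspace X" "p (snd w) = p y" "mdist K (a x2) (a (snd w)) = mdist K (a x1) (a y)"
      using w(1) unfolding w(2) C_def by (simp_all add: mem_Times_iff)
  qed
qed

section \<open>The fibre pseudometric on \<open>Z\<close>\<close>

definition fibdist :: "'c \<Rightarrow> 'c \<Rightarrow> real" where
  "fibdist z z' = Inf {mdist K (a x) (a x') |x x'. x \<in> mspace X \<and> x' \<in> mspace X \<and> p x = z \<and> p x' = z'}"

lemma fibdist_le: "x \<in> mspace X \<Longrightarrow> x' \<in> mspace X \<Longrightarrow> fibdist (p x) (p x') \<le> mdist K (a x) (a x')"
  unfolding fibdist_def by (rule cInf_lower) (auto intro!: bdd_belowI[of _ 0])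

text \<open>Compactness gives a closest point \<open>m\<close> to \<open>x\<close> only within the
  fibre over \<open>z\<close>. A competing pair \<open>(y, y')\<close> may start at another point
  over \<open>p x\<close>, but \<open>fibre_transfer\<close> replaces it by a pair starting at
  \<open>x\<close> with the same distance, so \<open>m\<close> realizes the infimum over all
  pairs.\<close>

lemma fibdist_attained:
  assumes x: "x \<in> mspace X" and z: "z \<in> mspace Z"
  obtains x' where "x' \<in> mspace X" "p x' = z" "mdist K (a x) (a x') = fibdist (p x) z"
proof -
  let ?F = "{x' \<in> mspace X. p x' = z}"
  have "closedin (mtopology_of X) ?F"
    using closedin_continuous_map_preimage[OF cont_p, of "{z}"] z closedin_Hausdorff_sing_eq[of "mtopology_of Z" z]
    by simp
  moreover have "?F \<noteq> {}"
    using factor_map_surj[OF fp z] by blast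
  moreover have "continuous_map (mtopology_of X) euclideanreal (\<lambda>x'. mdist K (a x) (a x'))"
    using a_in[OF x] by (intro continuous_map_mdist cont_a) simp
  ultimately obtain m where m: "m \<in> ?F" "\<And>y. y \<in> ?F \<Longrightarrow> mdist K (a x) (a m) \<le> mdist K (a x) (a y)"
    using compact_space_attains_inf[OF compact_X, of ?F] by blast
  have "fibdist (p x) z = mdist K (a x) (a m)"
    unfolding fibdist_def
  proof (rule cInf_eq_minimum)
    show "mdist K (a x) (a m) \<in> {mdist K (a y) (a y') |y y'. y \<in> mspace X \<and> y' \<in> mspace X \<and> p y = p x \<and> p y' = z}"
      using m(1) x by blast
    fix c
    assume "c \<in> {mdist K (a y) (a y') |y y'. y \<in> mspace X \<and> y' \<in> mspace X \<and> p y = p x \<and> p y' = z}"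
    then obtain y y' where y: "c = mdist K (a y) (a y')" "y \<in> mspace X" "y' \<in> mspace X" "p y = p x" "p y' = z"
      by blast
    obtain w where "w \<in> mspace X" "p w = p y'" "mdist K (a x) (a w) = mdist K (a y) (a y')"
      by (rule fibre_transfer[OF y(2) x y(4) y(3)])
    then show "mdist K (a x) (a m) \<le> c"
      using m(2)[of w] y by simp
  qed
  then show ?thesis
    using m(1) by (intro that[of m]) simp_all
qed

lemma fibdist_nonneg:
  assumes "z \<in> mspace Z" "z' \<in> mspace Z"
  shows "0 \<le> fibdist z z'"
proof -
  obtain x where x: "x \<in> mspace X" "p x = z"
    by (rule factor_map_surj[OF fp assms(1)])
  obtain x' where "mdist K (a x) (a x') = fibdist (p x) z'"
    by (rule fibdist_attained[OF x(1) assms(2)])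
  then show ?thesis
    using x mdist_nonneg[of K "a x" "a x'"] by simp
qed

lemma fibdist_commute: "fibdist z z' = fibdist z' z"
proof -
  let ?D = "\<lambda>z z'. {mdist K (a x) (a x') |x x'. x \<in> mspace X \<and> x' \<in> mspace X \<and> p x = z \<and> p x' = z'}"
  have "?D z z' \<subseteq> ?D z' z" for z z'
  proof
    fix c
    assume "c \<in> ?D z z'"
    then obtain x x' where x: "x \<in> mspace X" "x' \<in> mspace X" "p x = z" "p x' = z'"
      and c: "c = mdist K (a x) (a x')"
      by (elim CollectE exE conjE)
    have "c = mdist K (a x') (a x)"
      unfolding c by (rule mdist_commute)
    with x show "c \<in> ?D z' z"
      by (intro CollectI exI[of _ x'] exI[of _ x] conjI)
  qed
  then have "?D z z' = ?D z' z"
    by (intro subset_antisym)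
  then show ?thesis
    by (simp only: fibdist_def)
qed

lemma fibdist_refl:
  assumes "z \<in> mspace Z"
  shows "fibdist z z = 0"
proof -
  obtain x where x: "x \<in> mspace X" "p x = z"
    by (rule factor_map_surj[OF fp assms(1)])
  then have "fibdist z z \<le> 0"
    using fibdist_le[of x x] mdist_zero[OF a_in a_in, of x x] by simp
  then show ?thesis
    using fibdist_nonneg[OF assms assms] by linarith
qed

text \<open>Least distances between sets violate the triangle inequality in general. Here minimizing
  points can be chosen successively, each pair starting where the previous one ended, because
  \<open>fibdist_attained\<close> allows the first point to be prescribed.\<close>

lemma fibdist_triangle:
  assumes "z1 \<in> mspace Z" "z2 \<in> mspace Z" "z3 \<in> mspace Z"
  shows "fibdist z1 z3 \<le> fibdist z1 z2 + fibdist z2 z3"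
proof -
  obtain x1 where x1: "x1 \<in> mspace X" "p x1 = z1"
    by (rule factor_map_surj[OF fp assms(1)])
  obtain x2 where x2: "x2 \<in> mspace X" "p x2 = z2" "mdist K (a x1) (a x2) = fibdist (p x1) z2"
    by (rule fibdist_attained[OF x1(1) assms(2)])
  obtain x3 where x3: "x3 \<in> mspace X" "p x3 = z3" "mdist K (a x2) (a x3) = fibdist (p x2) z3"
    by (rule fibdist_attained[OF x2(1) assms(3)])
  show ?thesis
    using fibdist_le[OF x1(1) x3(1)] mdist_triangle[OF a_in a_in a_in, OF x1(1) x2(1) x3(1)] x1 x2 x3
    by simp
qed

text \<open>Since the infimum is attained from \<open>x\<close> itself, distance zero is witnessed
  by an actual coincidence in \<open>K\<close>.\<close>

lemma fibdist_zero_iff: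
  assumes x: "x \<in> mspace X" and z: "z \<in> mspace Z"
  shows "fibdist (p x) z = 0 \<longleftrightarrow> (\<exists>x'\<in>mspace X. p x' = z \<and> a x' = a x)"
proof
  assume 0: "fibdist (p x) z = 0"
  obtain x' where x': "x' \<in> mspace X" "p x' = z" "mdist K (a x) (a x') = fibdist (p x) z"
    by (rule fibdist_attained[OF x z])
  then have "a x' = a x"
    using 0 mdist_zero[OF a_in a_in, OF x x'(1)] by simp
  then show "\<exists>x'\<in>mspace X. p x' = z \<and> a x' = a x"
    using x' by blast
next
  assume "\<exists>x'\<in>mspace X. p x' = z \<and> a x' = a x"
  then obtain x' where x': "x' \<in> mspace X" "p x' = z" "a x' = a x"
    by blast
  then have "fibdist (p x) z \<le> 0"
    using fibdist_le[OF x x'(1)] mdist_zero[OF a_in a_in, OF x x'(1)] by simp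
  then show "fibdist (p x) z = 0"
    using fibdist_nonneg[OF p_in[OF x] z] by linarith
qed

text \<open>One inequality pushes a minimizing pair forward by \<open>T\<close>. For the other, a
  minimizing pair starting at \<open>T x\<close> is pulled back: \<open>T\<close> is onto, and
  injectivity of \<open>R\<close> shows that the pulled back point lies over
  \<open>z'\<close>.\<close>

lemma fibdist_invariant:
  assumes z: "z \<in> mspace Z" and z': "z' \<in> mspace Z"
  shows "fibdist (R z) (R z') = fibdist z z'"
proof (rule antisym)
  have bijX: "bij_betw T (mspace X) (mspace X)" and bijZ: "bij_betw R (mspace Z) (mspace Z)"
    using dyn_system_bij dynX dynZ by blast+
  obtain x where x: "x \<in> mspace X" "p x = z"
    by (rule factor_map_surj[OF fp z])
  obtain x' where x': "x' \<in> mspace X" "p x' = z'" "mdist K (a x) (a x') = fibdist (p x) z'"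
    by (rule fibdist_attained[OF x(1) z'])
  have "fibdist (p (T x)) (p (T x')) \<le> mdist K (a (T x)) (a (T x'))"
    by (rule fibdist_le[OF T_in T_in, OF x(1) x'(1)])
  then show "fibdist (R z) (R z') \<le> fibdist z z'"
    using x x' by (simp add: p_T a_T iso[OF a_in a_in])
  obtain y' where y': "y' \<in> mspace X" "p y' = R z'" "mdist K (a (T x)) (a y') = fibdist (p (T x)) (R z')"
    by (rule fibdist_attained[OF T_in[OF x(1)] bij_betw_apply[OF bijZ z']])
  have "y' \<in> T ` mspace X"
    using bij_betw_imp_surj_on[OF bijX] y'(1) by simp
  then obtain w where w: "y' = T w" "w \<in> mspace X"
    by (rule imageE)
  have "R (p w) = R z'"
    using y'(2) p_T[OF w(2)] w(1) by simp
  then have "p w = z'"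
    by (rule inj_onD[OF bij_betw_imp_inj_on[OF bijZ] _ p_in[OF w(2)] z'])
  then have "fibdist z z' \<le> mdist K (a x) (a w)"
    using fibdist_le[OF x(1) w(2)] x(2) by simp
  also have "\<dots> = mdist K (a (T x)) (a y')"
    using x(1) w(2) by (simp add: w(1) a_T iso[OF a_in a_in])
  also have "\<dots> = fibdist (R z) (R z')"
    using y'(3) x by (simp add: p_T)
  finally show "fibdist z z' \<le> fibdist (R z) (R z')" .
qed

text \<open>The quotient of \<open>Z\<close> by \<open>fibdist\<close> is carried by a set of representatives, hence by a
  subset of the type of \<open>Z\<close>.\<close>

definition rep :: "'c \<Rightarrow> 'c" where
  "rep z = (SOME w. w \<in> mspace Z \<and> fibdist z w = 0)"

lemma rep:
  assumes "z \<in> mspace Z"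
  shows rep_in: "rep z \<in> mspace Z" and fibdist_rep: "fibdist z (rep z) = 0"
  using someI[of "\<lambda>w. w \<in> mspace Z \<and> fibdist z w = 0" z] fibdist_refl[OF assms] assms
  by (auto simp: rep_def)

lemma fibdist_rep_rep:
  assumes "z \<in> mspace Z" "z' \<in> mspace Z"
  shows "fibdist (rep z) (rep z') = fibdist z z'"
proof -
  note r = rep_in[OF assms(1)] rep_in[OF assms(2)] fibdist_rep[OF assms(1)] fibdist_rep[OF assms(2)]
  show ?thesis
    using fibdist_triangle[OF assms(1) r(1) assms(2)] fibdist_triangle[OF r(1) r(2) assms(2)]
      fibdist_triangle[OF r(1) assms(1) r(2)] fibdist_triangle[OF assms(1) assms(2) r(2)] r
      fibdist_commute[of z "rep z"] fibdist_commute[of z' "rep z'"]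
    by linarith
qed

lemma rep_eq_iff:
  assumes z: "z \<in> mspace Z" and z': "z' \<in> mspace Z"
  shows "rep z = rep z' \<longleftrightarrow> fibdist z z' = 0"
proof
  assume "rep z = rep z'"
  then show "fibdist z z' = 0"
    using fibdist_rep_rep[OF assms] fibdist_refl[OF rep_in[OF z]] by simp
next
  assume 0: "fibdist z z' = 0"
  have "fibdist z w = 0 \<longleftrightarrow> fibdist z' w = 0" if w: "w \<in> mspace Z" for w
    using fibdist_triangle[OF z z' w] fibdist_triangle[OF z' z w] 0 fibdist_commute[of z z']
      fibdist_nonneg[OF z w] fibdist_nonneg[OF z' w] by linarith
  then have "(\<lambda>w. w \<in> mspace Z \<and> fibdist z w = 0) = (\<lambda>w. w \<in> mspace Z \<and> fibdist z' w = 0)"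
    by blast
  then show "rep z = rep z'"
    by (simp add: rep_def)
qed

text \<open>The value 0 outside \<open>mspace Z\<close> secures the global nonnegativity required by
  \<open>Metric_space\<close>; there \<open>fibdist\<close> is the infimum of an empty set.\<close>

definition quot :: "'c metric" where
  "quot = metric (rep ` mspace Z, \<lambda>u v. if u \<in> mspace Z \<and> v \<in> mspace Z then fibdist u v else 0)"

lemma Metric_space_quot:
  "Metric_space (rep ` mspace Z) (\<lambda>u v. if u \<in> mspace Z \<and> v \<in> mspace Z then fibdist u v else 0)"
proof
  fix u v w
  show "0 \<le> (if u \<in> mspace Z \<and> v \<in> mspace Z then fibdist u v else 0)"
    using fibdist_nonneg by simp
  show "(if u \<in> mspace Z \<and> v \<in> mspace Z then fibdist u v else 0)
      = (if v \<in> mspace Z \<and> u \<in> mspace Z then fibdist v u else 0)"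
    using fibdist_commute by simp
  assume "u \<in> rep ` mspace Z" "v \<in> rep ` mspace Z"
  then obtain z z' where z: "z \<in> mspace Z" "u = rep z" "z' \<in> mspace Z" "v = rep z'"
    by blast
  then show "((if u \<in> mspace Z \<and> v \<in> mspace Z then fibdist u v else 0) = 0) = (u = v)"
    by (simp add: rep_in fibdist_rep_rep rep_eq_iff)
  assume "w \<in> rep ` mspace Z"
  then have "w \<in> mspace Z"
    using rep_in by blast
  then show "(if u \<in> mspace Z \<and> w \<in> mspace Z then fibdist u w else 0)
      \<le> (if u \<in> mspace Z \<and> v \<in> mspace Z then fibdist u v else 0)
      + (if v \<in> mspace Z \<and> w \<in> mspace Z then fibdist v w else 0)"
    using z fibdist_triangle by (simp add: rep_in)
qed

lemma mspace_quot: "mspace quot = rep ` mspace Z"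
  unfolding quot_def by (rule Metric_space.mspace_metric[OF Metric_space_quot])

lemma mdist_quot:
  assumes "z \<in> mspace Z" "z' \<in> mspace Z"
  shows "mdist quot (rep z) (rep z') = fibdist z z'"
  unfolding quot_def Metric_space.mdist_metric[OF Metric_space_quot]
  using assms by (simp add: rep_in fibdist_rep_rep)

section \<open>The induced system on the quotient\<close>

definition quot_map :: "'c \<Rightarrow> 'c" where
  "quot_map u = rep (R u)"

lemma R_in: "z \<in> mspace Z \<Longrightarrow> R z \<in> mspace Z"
  using dyn_system_bij[OF dynZ] by (rule bij_betw_apply)

text \<open>By invariance of \<open>fibdist\<close>, the class of \<open>R z\<close> depends only on
  the class of \<open>z\<close>.\<close>

lemma quot_map_rep:
  assumes z: "z \<in> mspace Z"
  shows "quot_map (rep z) = rep (R z)"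
  unfolding quot_map_def rep_eq_iff[OF R_in[OF rep_in[OF z]] R_in[OF z]]
  using fibdist_invariant[OF rep_in[OF z] z] fibdist_rep[OF z] fibdist_commute[of z "rep z"] by simp

text \<open>The map factors through \<open>a\<close>, and the resulting map from \<open>K\<close> to
  \<open>quot\<close> does not increase distances because \<open>fibdist\<close> is an infimum of
  distances in \<open>K\<close>.\<close>

lemma continuous_map_rep_p: "continuous_map (mtopology_of X) (mtopology_of quot) (\<lambda>x. rep (p x))"
proof -
  define q where "q = rep \<circ> p \<circ> inv_into (mspace X) a"
  have q: "q (a x) = rep (p x)" if x: "x \<in> mspace X" for x
  proof -
    let ?x = "inv_into (mspace X) a (a x)"
    have x': "?x \<in> mspace X" "a ?x = a x"
      using x by (simp_all add: inv_into_into f_inv_into_f)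
    then have "fibdist (p x) (p ?x) = 0"
      using fibdist_zero_iff[OF x p_in[OF x'(1)]] by blast
    then show ?thesis
      using rep_eq_iff[OF p_in[OF x] p_in[OF x'(1)]] by (simp add: q_def)
  qed
  have "continuous_map (mtopology_of K) (mtopology_of quot) q"
    unfolding continuous_map_mtopology_of_iff
  proof (intro conjI ballI allI impI)
    have "q u \<in> mspace quot" if u: "u \<in> mspace K" for u
    proof -
      obtain x where x: "x \<in> mspace X" "a x = u"
        by (rule factor_map_surj[OF fa u])
      then have "q u = rep (p x)"
        using q by blast
      then show ?thesis
        using p_in[OF x(1)] by (simp add: mspace_quot)
    qed
    then show "q ` mspace K \<subseteq> mspace quot"
      by blast
    fix u and \<epsilon> :: real
    assume u: "u \<in> mspace K" and "\<epsilon> > 0"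
    have "mdist quot (q u) (q v) \<le> mdist K u v" if v: "v \<in> mspace K" for v
    proof -
      obtain x where x: "x \<in> mspace X" "a x = u"
        by (rule factor_map_surj[OF fa u])
      obtain y where y: "y \<in> mspace X" "a y = v"
        by (rule factor_map_surj[OF fa v])
      have "mdist quot (rep (p x)) (rep (p y)) \<le> mdist K (a x) (a y)"
        using fibdist_le[OF x(1) y(1)] mdist_quot[OF p_in p_in, OF x(1) y(1)] by simp
      then show ?thesis
        by (simp only: q[OF x(1), unfolded x(2)] q[OF y(1), unfolded y(2)] x(2) y(2))
    qed
    then show "\<exists>\<delta>>0. \<forall>v. v \<in> mspace K \<and> mdist K u v < \<delta> \<longrightarrow> mdist quot (q u) (q v) < \<epsilon>"
      using \<open>\<epsilon> > 0\<close> le_less_trans by (intro exI[of _ \<epsilon>] conjI allI impI) blast+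
  qed
  then have "continuous_map (mtopology_of X) (mtopology_of quot) (q \<circ> a)"
    by (rule continuous_map_compose[OF cont_a])
  then show ?thesis
    by (rule continuous_map_eq) (simp add: q)
qed

text \<open>The metric of \<open>quot\<close> was built from that of \<open>K\<close>, not from that
  of \<open>Z\<close>. Continuity of \<open>rep\<close> is therefore obtained on \<open>X\<close>
  and brought down along the quotient map \<open>p\<close>.\<close>

lemma factor_map_rep: "factor_map Z R quot quot_map rep"
proof -
  have "continuous_map (mtopology_of X) (mtopology_of quot) (rep \<circ> p)"
    using continuous_map_rep_p by (simp add: o_def)
  then have "continuous_map (mtopology_of Z) (mtopology_of quot) rep"
    by (rule continuous_compose_quotient_map[OF factor_map_quotient_map[OF dynX fp]])
  then show ?thesis
    by (simp add: factor_map_def mspace_quot quot_map_rep)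
qed

lemma quot_map_isometry:
  assumes "u \<in> mspace quot" "v \<in> mspace quot"
  shows "mdist quot (quot_map u) (quot_map v) = mdist quot u v"
proof -
  obtain z z' where z: "z \<in> mspace Z" "u = rep z" "z' \<in> mspace Z" "v = rep z'"
    using assms by (auto simp: mspace_quot)
  then show ?thesis
    by (simp add: quot_map_rep mdist_quot R_in fibdist_invariant)
qed

text \<open>Compactness is inherited from \<open>Z\<close>. The induced map is a surjective
  isometry, hence a continuous bijection of a compact Hausdorff space.\<close>

lemma dyn_system_quot: "dyn_system quot quot_map"
proof -
  have compact: "compact_space (mtopology_of quot)"
  proof -
    have "compactin (mtopology_of quot) (rep ` topspace (mtopology_of Z))"
      using dynZ factor_map_rep
      by (intro image_compactin[of "mtopology_of Z"]) (simp_all add: dyn_system_def compact_space_def factor_map_def)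
    then show ?thesis
      by (simp add: compact_space_def mspace_quot)
  qed
  have R: "R ` mspace Z = mspace Z"
    using dyn_system_bij[OF dynZ] by (simp add: bij_betw_def)
  have img: "quot_map ` mspace quot = mspace quot"
  proof -
    have "quot_map ` rep ` mspace Z = rep ` R ` mspace Z"
      unfolding image_image by (intro image_cong refl quot_map_rep)
    then show ?thesis
      by (simp add: R mspace_quot)
  qed
  have inj: "inj_on quot_map (mspace quot)"
  proof (rule inj_onI)
    fix u v
    assume uv: "u \<in> mspace quot" "v \<in> mspace quot" and eq: "quot_map u = quot_map v"
    have "quot_map v \<in> mspace quot"
      using img uv(2) by blast
    then have "mdist quot u v = 0"
      using quot_map_isometry[OF uv] eq mdist_zero[of "quot_map v" quot "quot_map v"] by simp
    then show "u = v"
      using uv by simp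
  qed
  have "continuous_map (mtopology_of quot) (mtopology_of quot) quot_map"
    unfolding continuous_map_mtopology_of_iff
  proof (intro conjI ballI allI impI)
    show "quot_map ` mspace quot \<subseteq> mspace quot"
      using img by simp
    fix u and \<epsilon> :: real
    assume "u \<in> mspace quot" "\<epsilon> > 0"
    then show "\<exists>\<delta>>0. \<forall>v. v \<in> mspace quot \<and> mdist quot u v < \<delta> \<longrightarrow> mdist quot (quot_map u) (quot_map v) < \<epsilon>"
      by (intro exI[of _ \<epsilon>]) (simp add: quot_map_isometry)
  qed
  then have "homeomorphic_map (mtopology_of quot) (mtopology_of quot) quot_map"
    using compact img inj by (intro continuous_imp_homeomorphic_map) simp_all
  then show ?thesis
    using compact by (simp add: dyn_system_def)
qed

lemma equicontinuous_quot: "equicontinuous_system quot quot_map"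
  by (rule equicontinuous_system_isometric[OF dyn_system_quot quot_map_isometry])

text \<open>From right to left this makes the class of \<open>p x\<close> a function of
  \<open>a x\<close>, which gives the base map from \<open>K\<close> to \<open>quot\<close>. From
  left to right it is the lifting property.\<close>

lemma rep_p_eq_iff:
  assumes x: "x \<in> mspace X" and z: "z \<in> mspace Z"
  shows "rep (p x) = rep z \<longleftrightarrow> (\<exists>x'\<in>mspace X. p x' = z \<and> a x' = a x)"
  by (simp only: rep_eq_iff[OF p_in[OF x] z] fibdist_zero_iff[OF x z])

end

section \<open>Images of residual sets\<close>

text \<open>Total boundedness gives a finite net for each radius \<open>1 / (n + 1)\<close>; the
  balls around all these nets form the base.\<close>

lemma compact_metric_countable_base:
  fixes E :: "'e metric"
  assumes "compact_space (mtopology_of E)"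
  obtains \<B> where "countable \<B>" "\<And>V. V \<in> \<B> \<Longrightarrow> openin (mtopology_of E) V"
    "\<And>U u. openin (mtopology_of E) U \<Longrightarrow> u \<in> U \<Longrightarrow> \<exists>V\<in>\<B>. u \<in> V \<and> V \<subseteq> U"
proof -
  interpret E: Metric_space "mspace E" "mdist E"
    by simp
  have "E.mtotally_bounded (mspace E)"
    using assms by (intro E.compactin_imp_mtotally_bounded) (simp add: mtopology_of_def compact_space_def)
  then have "\<exists>K. finite K \<and> K \<subseteq> mspace E \<and> mspace E \<subseteq> (\<Union>x\<in>K. E.mball x (inverse (real (Suc n))))" for n
    unfolding E.mtotally_bounded_def by (simp del: of_nat_Suc)
  then obtain K where fin: "\<And>n. finite (K n)"
    and cover: "\<And>n. mspace E \<subseteq> (\<Union>x\<in>K n. E.mball x (inverse (real (Suc n))))"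
    by metis
  define \<B> where "\<B> = (\<Union>n. (\<lambda>x. E.mball x (inverse (real (Suc n)))) ` K n)"
  show ?thesis
  proof
    show "countable \<B>"
      unfolding \<B>_def by (intro countable_UN countableI_type countable_image countable_finite fin)
    show "openin (mtopology_of E) V" if "V \<in> \<B>" for V
      using that by (auto simp: \<B>_def mtopology_of_def)
    fix U u
    assume "openin (mtopology_of E) U" and u: "u \<in> U"
    then obtain r where "r > 0" and r: "E.mball u r \<subseteq> U" and uE: "u \<in> mspace E"
      unfolding mtopology_of_def E.openin_mtopology by blast
    \<comment> \<open>A ball of radius below \<open>r / 2\<close> that contains \<open>u\<close>
      lies in the ball of radius \<open>r\<close> around \<open>u\<close>.\<close>
    obtain n where n: "inverse (real (Suc n)) < r / 2"
      using reals_Archimedean[of "r / 2"] \<open>r > 0\<close> by auto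
    obtain x where x: "x \<in> K n" "u \<in> E.mball x (inverse (real (Suc n)))"
      using cover[of n] uE by blast
    have "w \<in> E.mball u r" if w: "w \<in> E.mball x (inverse (real (Suc n)))" for w
    proof -
      have "mdist E u w \<le> mdist E x u + mdist E x w"
        using w x(2) mdist_triangle[of u E x w] mdist_commute[of E u x] by simp
      then show ?thesis
        using w x(2) n uE by simp
    qed
    then show "\<exists>V\<in>\<B>. u \<in> V \<and> V \<subseteq> U"
      using x r unfolding \<B>_def by blast
  qed
qed

text \<open>By openness, for \<open>z\<close> in a residual set every basic open set meeting the fibre over \<open>z\<close>
  meets it inside each of the given dense open sets; the Baire category theorem in the fibre
  then provides a point of the fibre in all of them.\<close>

lemma residual_in_open_map_image:
  fixes E :: "'e metric" and F :: "'f metric"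
  assumes E: "compact_space (mtopology_of E)"
    and cont: "continuous_map (mtopology_of E) (mtopology_of F) q"
    and op: "open_map (mtopology_of E) (mtopology_of F) q"
    and surj: "q ` mspace E = mspace F" and \<Omega>: "residual_in (mtopology_of E) \<Omega>"
  shows "residual_in (mtopology_of F) (q ` \<Omega>)"
proof -
  let ?E = "mtopology_of E" and ?F = "mtopology_of F"
  obtain \<U> where "countable \<U>" and \<U>: "\<And>U. U \<in> \<U> \<Longrightarrow> openin ?E U"
      "\<And>U. U \<in> \<U> \<Longrightarrow> ?E closure_of U = mspace E" and sub: "mspace E \<inter> \<Inter>\<U> \<subseteq> \<Omega>" and \<Omega>E: "\<Omega> \<subseteq> mspace E"
    using \<Omega> unfolding residual_in_def by auto
  obtain \<B> where "countable \<B>" and \<B>: "\<And>V. V \<in> \<B> \<Longrightarrow> openin ?E V"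
      "\<And>U u. openin ?E U \<Longrightarrow> u \<in> U \<Longrightarrow> \<exists>V\<in>\<B>. u \<in> V \<and> V \<subseteq> U"
    by (rule compact_metric_countable_base[OF E]) blast
  define W where "W U V = q ` (V \<inter> U) \<union> (mspace F - ?F closure_of (q ` V))" for U V
  have qV: "openin ?F (q ` V)" if "openin ?E V" for V
    using op that by (simp add: open_map_def)
  have W_open: "openin ?F (W U V)" if "U \<in> \<U>" "V \<in> \<B>" for U V
    unfolding W_def using that \<U>(1) \<B>(1)
    by (intro openin_Un qV openin_Int) (auto intro: openin_diff simp flip: topspace_mtopology_of)
  have W_dense: "?F closure_of W U V = topspace ?F" if "U \<in> \<U>" "V \<in> \<B>" for U V
    unfolding dense_intersects_open
  proof (intro allI impI, elim conjE)
    fix N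
    assume N: "openin ?F N" "N \<noteq> {}"
    show "W U V \<inter> N \<noteq> {}"
    proof (cases "N \<inter> q ` V = {}")
      case True
      then have "N \<inter> ?F closure_of (q ` V) = {}"
        using openin_Int_closure_of_eq_empty[OF N(1)] by blast
      moreover have "N \<subseteq> mspace F"
        using openin_subset[OF N(1)] by simp
      ultimately show ?thesis
        using N(2) unfolding W_def by blast
    next
      case False
      then have "{x \<in> topspace ?E. q x \<in> N} \<inter> V \<noteq> {}"
        using openin_subset[OF \<B>(1)[OF that(2)]] by blast
      moreover have "openin ?E ({x \<in> topspace ?E. q x \<in> N} \<inter> V)"
        using openin_continuous_map_preimage[OF cont N(1)] \<B>(1)[OF that(2)] by blast
      ultimately have "U \<inter> ({x \<in> topspace ?E. q x \<in> N} \<inter> V) \<noteq> {}"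
        using \<U>(2)[OF that(1)] dense_intersects_open[of ?E U] by simp
      then show ?thesis
        unfolding W_def by blast
    qed
  qed
  have "z \<in> q ` \<Omega>" if z: "z \<in> mspace F" and zW: "\<And>U V. U \<in> \<U> \<Longrightarrow> V \<in> \<B> \<Longrightarrow> z \<in> W U V" for z
  proof -
    define A where "A = {x \<in> topspace ?E. q x \<in> {z}}"
    have clA: "closedin ?E A"
      unfolding A_def using z
      by (intro closedin_continuous_map_preimage[OF cont]) (simp add: closedin_Hausdorff_sing_eq)
    have tA: "topspace (subtopology ?E A) = A"
      using closedin_subset[OF clA] by (simp add: Int_absorb1)
    have "compact_space (subtopology ?E A)"
      using closedin_compact_space[OF E clA] compact_space_subtopology by blast
    moreover have "Hausdorff_space (subtopology ?E A)"
      by (simp add: Hausdorff_space_subtopology)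
    ultimately have baire: "locally_compact_space (subtopology ?E A) \<and> regular_space (subtopology ?E A)"
      using compact_imp_locally_compact_space compact_Hausdorff_imp_regular_space by blast
    have dense: "subtopology ?E A closure_of (A \<inter> U) = topspace (subtopology ?E A)" if U: "U \<in> \<U>" for U
      unfolding dense_intersects_open
    proof (intro allI impI, elim conjE)
      fix N
      assume "openin (subtopology ?E A) N" "N \<noteq> {}"
      then obtain O' x where O': "openin ?E O'" "N = O' \<inter> A" "x \<in> O'" "x \<in> A"
        unfolding openin_subtopology by blast
      obtain V where V: "V \<in> \<B>" "x \<in> V" "V \<subseteq> O'"
        using \<B>(2)[OF O'(1,3)] by blast
      have "z \<in> q ` V"
        using O'(4) V(2) by (auto simp: A_def)
      moreover have "q ` V \<subseteq> ?F closure_of (q ` V)"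
        by (intro closure_of_subset openin_subset qV \<B>(1) V(1))
      ultimately have "z \<in> q ` (V \<inter> U)"
        using zW[OF U V(1)] unfolding W_def by blast
      then obtain y where y: "z = q y" "y \<in> V \<inter> U"
        by (rule imageE)
      moreover have "y \<in> topspace ?E"
        using openin_subset[OF \<B>(1)[OF V(1)]] y(2) by blast
      ultimately show "A \<inter> U \<inter> N \<noteq> {}"
        using V(3) O'(2) unfolding A_def by blast
    qed
    have "subtopology ?E A closure_of \<Inter>((\<inter>) A ` \<U>) = topspace (subtopology ?E A)"
    proof (rule Baire_category)
      fix N
      assume "N \<in> (\<inter>) A ` \<U>"
      then obtain U where U: "U \<in> \<U>" "N = A \<inter> U"
        by blast
      then show "openin (subtopology ?E A) N \<and> subtopology ?E A closure_of N = topspace (subtopology ?E A)"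
        using dense[OF U(1)] openin_subtopology_Int2[OF \<U>(1)[OF U(1)]] by simp
    qed (use baire \<open>countable \<U>\<close> in auto)
    \<comment> \<open>The Baire theorem yields a dense intersection; it contains a point because the
      fibre is nonempty.\<close>
    moreover have "A \<noteq> {}"
    proof -
      have "z \<in> q ` mspace E"
        using z surj by simp
      then show ?thesis
        by (auto simp: A_def)
    qed
    ultimately have "A \<inter> \<Inter>((\<inter>) A ` \<U>) \<noteq> {}"
      using closure_of_restrict[of "subtopology ?E A" "\<Inter>((\<inter>) A ` \<U>)"] unfolding tA by force
    then obtain x where "x \<in> A" "x \<in> \<Inter>\<U>"
      by blast
    then have "x \<in> \<Omega>" "q x = z"
      using sub by (auto simp: A_def)
    then show ?thesis
      by blast
  qed
  moreover have "countable (case_prod W ` (\<U> \<times> \<B>))"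
    using \<open>countable \<U>\<close> \<open>countable \<B>\<close> by (intro countable_image countable_SIGMA)
  moreover have "q ` \<Omega> \<subseteq> mspace F"
    using \<Omega>E surj by blast
  ultimately show ?thesis
    unfolding residual_in_def
    using W_open W_dense by (intro conjI exI[of _ "case_prod W ` (\<U> \<times> \<B>)"]) auto
qed

section \<open>Factors of group rotations\<close>

lemma group_rotationD:
  assumes "group_rotation E Q G g"
  shows "comm_group G" "carrier G = mspace E" "g \<in> mspace E"
    "\<And>x. x \<in> mspace E \<Longrightarrow> Q x = x \<otimes>\<^bsub>G\<^esub> g"
  using assms by (auto simp: group_rotation_def)

lemma continuous_map_rotation_translate:
  assumes G: "group_rotation E Q G g"
    and "continuous_map X (mtopology_of E) f" "continuous_map X (mtopology_of E) h"
  shows "continuous_map X (mtopology_of E) (\<lambda>x. f x \<otimes>\<^bsub>G\<^esub> h x)"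
proof -
  have "continuous_map X (prod_topology (mtopology_of E) (mtopology_of E)) (\<lambda>x. (f x, h x))"
    using assms by (simp add: continuous_map_paired)
  moreover have "continuous_map (prod_topology (mtopology_of E) (mtopology_of E)) (mtopology_of E)
      (\<lambda>(x, y). x \<otimes>\<^bsub>G\<^esub> y)"
    using G by (simp add: group_rotation_def)
  ultimately have "continuous_map X (mtopology_of E) ((\<lambda>(x, y). x \<otimes>\<^bsub>G\<^esub> y) \<circ> (\<lambda>x. (f x, h x)))"
    by (rule continuous_map_compose)
  then show ?thesis
    by (simp add: o_def)
qed

text \<open>In an abelian group every translation commutes with the rotation \<open>Q\<close>, hence
  with its iterates.\<close>

lemma group_rotation_ziter:
  assumes G: "group_rotation E Q G g" and Q: "dyn_system E Q"
    and w: "w \<in> mspace E" and u: "u \<in> mspace E"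
  shows "ziter (mspace E) Q n w \<otimes>\<^bsub>G\<^esub> u = ziter (mspace E) Q n (w \<otimes>\<^bsub>G\<^esub> u)"
proof -
  interpret comm_group G
    by (rule group_rotationD(1)[OF G])
  note c = group_rotationD(2)[OF G]
  have closed: "x \<otimes>\<^bsub>G\<^esub> y \<in> mspace E" if "x \<in> mspace E" "y \<in> mspace E" for x y
    using m_closed that by (simp add: c)
  have "Q x \<otimes>\<^bsub>G\<^esub> u = Q (x \<otimes>\<^bsub>G\<^esub> u)" if "x \<in> mspace E" for x
    using that u group_rotationD(3)[OF G] group_rotationD(4)[OF G] closed
    by (simp add: c m_assoc m_comm m_lcomm)
  then show ?thesis
    using ziter_equivariant[OF dyn_system_bij[OF Q] dyn_system_bij[OF Q], of "\<lambda>w. w \<otimes>\<^bsub>G\<^esub> u" w n]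
      closed u w by (simp add: image_subset_iff)
qed

text \<open>For \<open>w\<close> in the orbit of the identity, translation by \<open>w\<close> is an
  iterate of \<open>Q\<close>, and \<open>q\<close> intertwines iterates. The condition on
  \<open>w\<close> is closed, so minimality extends it to all of \<open>E\<close>.\<close>

lemma group_rotation_translate_fibre:
  assumes G: "group_rotation E Q G g" and E: "minimal_system E Q" and F: "dyn_system F P"
    and q: "factor_map E Q F P q"
    and u: "u \<in> mspace E" and v: "v \<in> mspace E" and eq: "q u = q v" and w: "w \<in> mspace E"
  shows "q (w \<otimes>\<^bsub>G\<^esub> u) = q (w \<otimes>\<^bsub>G\<^esub> v)"
proof -
  interpret comm_group G
    by (rule group_rotationD(1)[OF G])
  note c = group_rotationD(2)[OF G]
  have dE: "dyn_system E Q"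
    using E by (simp add: minimal_system_def)
  have contq: "continuous_map (mtopology_of E) (mtopology_of F) q"
    using q by (simp add: factor_map_def)
  have cont: "continuous_map (mtopology_of E) (mtopology_of F) (\<lambda>w. q (w \<otimes>\<^bsub>G\<^esub> u))" if "u \<in> mspace E" for u
    using continuous_map_compose[OF continuous_map_rotation_translate[OF G, of "mtopology_of E" id "\<lambda>_. u"] contq]
      that by (simp add: o_def)
  have one: "\<one>\<^bsub>G\<^esub> \<in> mspace E"
    using one_closed by (simp add: c)
  have "{w \<in> mspace E. q (w \<otimes>\<^bsub>G\<^esub> u) = q (w \<otimes>\<^bsub>G\<^esub> v)} = mspace E"
  proof (rule minimal_orbit_closed[OF E one])
    show "closedin (mtopology_of E) {w \<in> mspace E. q (w \<otimes>\<^bsub>G\<^esub> u) = q (w \<otimes>\<^bsub>G\<^esub> v)}"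
      using closedin_continuous_maps_eq[OF Hausdorff_space_mtopology_of cont[OF u] cont[OF v]] by simp
    fix n
    have "q (ziter (mspace E) Q n \<one>\<^bsub>G\<^esub> \<otimes>\<^bsub>G\<^esub> x) = ziter (mspace F) P n (q x)" if "x \<in> mspace E" for x
      using group_rotation_ziter[OF G dE one that] factor_map_ziter[OF dE F q that] that by (simp add: c)
    then show "ziter (mspace E) Q n \<one>\<^bsub>G\<^esub> \<in> {w \<in> mspace E. q (w \<otimes>\<^bsub>G\<^esub> u) = q (w \<otimes>\<^bsub>G\<^esub> v)}"
      using u v eq ziter_in[OF dyn_system_bij[OF dE] one] by simp
  qed
  then show ?thesis
    using w by blast
qed

text \<open>Choose \<open>c\<close> with \<open>\<eta>1 c\<close> equal to the value of
  \<open>\<eta>2\<close> at the identity. Then \<open>\<eta>2\<close> and the translate of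
  \<open>\<eta>1\<close> by \<open>c\<close> agree at the identity, hence along its dense
  orbit.\<close>

lemma group_rotation_factor_maps_translate:
  assumes G: "group_rotation E Q G g" and E: "minimal_system E Q" and W: "dyn_system W P"
    and \<eta>1: "factor_map E Q W P \<eta>1" and \<eta>2: "factor_map E Q W P \<eta>2"
  obtains c where "c \<in> mspace E" "\<And>u. u \<in> mspace E \<Longrightarrow> \<eta>2 u = \<eta>1 (c \<otimes>\<^bsub>G\<^esub> u)"
proof -
  interpret comm_group G
    by (rule group_rotationD(1)[OF G])
  note carr = group_rotationD(2)[OF G]
  have dE: "dyn_system E Q"
    using E by (simp add: minimal_system_def)
  have one: "\<one>\<^bsub>G\<^esub> \<in> mspace E"
    using one_closed by (simp add: carr)
  obtain c where c: "c \<in> mspace E" "\<eta>1 c = \<eta>2 \<one>\<^bsub>G\<^esub>"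
    by (rule factor_map_surj[OF \<eta>1 factor_map_in[OF \<eta>2 one]])
  have cont1: "continuous_map (mtopology_of E) (mtopology_of W) (\<lambda>u. \<eta>1 (u \<otimes>\<^bsub>G\<^esub> c))"
    using continuous_map_compose[OF continuous_map_rotation_translate[OF G, of "mtopology_of E" id "\<lambda>_. c"]
        factor_map_continuous[OF \<eta>1]] c(1) by (simp add: o_def)
  have cont2: "continuous_map (mtopology_of E) (mtopology_of W) \<eta>2"
    by (rule factor_map_continuous[OF \<eta>2])
  have eq: "{u \<in> mspace E. \<eta>2 u = \<eta>1 (u \<otimes>\<^bsub>G\<^esub> c)} = mspace E"
  proof (rule minimal_orbit_closed[OF E one])
    show "closedin (mtopology_of E) {u \<in> mspace E. \<eta>2 u = \<eta>1 (u \<otimes>\<^bsub>G\<^esub> c)}"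
      using closedin_continuous_maps_eq[OF Hausdorff_space_mtopology_of cont2 cont1] by simp
    fix n
    have "\<eta>1 (ziter (mspace E) Q n \<one>\<^bsub>G\<^esub> \<otimes>\<^bsub>G\<^esub> c) = \<eta>2 (ziter (mspace E) Q n \<one>\<^bsub>G\<^esub>)"
      using group_rotation_ziter[OF G dE one c(1)] factor_map_ziter[OF dE W \<eta>1 c(1)]
        factor_map_ziter[OF dE W \<eta>2 one] c by (simp add: carr)
    then show "ziter (mspace E) Q n \<one>\<^bsub>G\<^esub> \<in> {u \<in> mspace E. \<eta>2 u = \<eta>1 (u \<otimes>\<^bsub>G\<^esub> c)}"
      using ziter_in[OF dyn_system_bij[OF dE] one] by simp
  qed
  show ?thesis
  proof (rule that[OF c(1)])
    fix u
    assume u: "u \<in> mspace E"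
    then have "u \<in> {u \<in> mspace E. \<eta>2 u = \<eta>1 (u \<otimes>\<^bsub>G\<^esub> c)}"
      unfolding eq .
    then show "\<eta>2 u = \<eta>1 (c \<otimes>\<^bsub>G\<^esub> u)"
      using u c(1) by (simp add: carr m_comm)
  qed
qed

text \<open>The product on \<open>F\<close> is computed on representatives chosen by a section
  \<open>s\<close> of \<open>q\<close>. Independence of the choice follows by applying
  \<open>group_rotation_translate_fibre\<close> to one argument at a time, with commutativity in
  between.\<close>

lemma group_rotation_factor:
  assumes G: "group_rotation E Q G g" and E: "minimal_system E Q" and F: "dyn_system F P"
    and q: "factor_map E Q F P q"
  obtains H h where "group_rotation F P H h" "q \<in> hom G H"
proof -
  interpret comm_group G
    by (rule group_rotationD(1)[OF G])
  note c = group_rotationD(2)[OF G]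
  have dE: "dyn_system E Q"
    using E by (simp add: minimal_system_def)
  have surj: "q ` mspace E = mspace F" and contq: "continuous_map (mtopology_of E) (mtopology_of F) q"
    using q by (simp_all add: factor_map_def)
  have closed: "x \<otimes>\<^bsub>G\<^esub> y \<in> mspace E" if "x \<in> mspace E" "y \<in> mspace E" for x y
    using m_closed that by (simp add: c)
  define s where "s = inv_into (mspace E) q"
  have s: "s (q x) \<in> mspace E" "q (s (q x)) = q x" if "x \<in> mspace E" for x
    using that by (simp_all add: s_def inv_into_into f_inv_into_f)
  define H where "H = \<lparr>carrier = q ` carrier G, mult = \<lambda>a b. q (s a \<otimes>\<^bsub>G\<^esub> s b), one = q \<one>\<^bsub>G\<^esub>\<rparr>"
  have carrH: "carrier H = mspace F"
    by (simp add: H_def c surj)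
  have multH: "q x \<otimes>\<^bsub>H\<^esub> q y = q (x \<otimes>\<^bsub>G\<^esub> y)" if x: "x \<in> mspace E" and y: "y \<in> mspace E" for x y
  proof -
    have "q (s (q x) \<otimes>\<^bsub>G\<^esub> s (q y)) = q (s (q x) \<otimes>\<^bsub>G\<^esub> y)"
      by (rule group_rotation_translate_fibre[OF G E F q s(1)[OF y] y s(2)[OF y] s(1)[OF x]])
    also have "\<dots> = q (y \<otimes>\<^bsub>G\<^esub> s (q x))"
      using s(1)[OF x] y by (simp add: c m_comm)
    also have "\<dots> = q (y \<otimes>\<^bsub>G\<^esub> x)"
      by (rule group_rotation_translate_fibre[OF G E F q s(1)[OF x] x s(2)[OF x] y])
    also have "\<dots> = q (x \<otimes>\<^bsub>G\<^esub> y)"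
      using x y by (simp add: c m_comm)
    finally show ?thesis
      by (simp add: H_def)
  qed
  have hom: "q \<in> hom G H"
    unfolding hom_def using surj by (auto simp: c carrH multH)
  \<comment> \<open>The result on images of commutative groups speaks about a record with updated
    carrier and unit; \<open>H\<close> was defined so that the update changes nothing.\<close>
  have "H\<lparr>carrier := q ` carrier G, one := q \<one>\<^bsub>G\<^esub>\<rparr> = H"
    by (simp add: H_def)
  then have commH: "comm_group H"
    using hom_imp_img_comm_group[OF hom] by simp
  then interpret H: comm_group H .
  interpret group_hom G H q
    using hom by unfold_locales
  have gE: "g \<in> mspace E"
    by (rule group_rotationD(3)[OF G])
  have "group_rotation F P H (q g)"
    unfolding group_rotation_def
  proof (intro conjI ballI)
    show "compact_space (mtopology_of F)"
      using F by (simp add: dyn_system_def)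
    show "comm_group H" "carrier H = mspace F"
      by (fact commH carrH)+
    \<comment> \<open>The square of \<open>q\<close> is again a quotient map, so joint continuity of
      the multiplication descends from \<open>E\<close> to \<open>F\<close>.\<close>
    let ?qq = "\<lambda>(x, y). (q x, q y)"
    let ?EE = "prod_topology (mtopology_of E) (mtopology_of E)"
      and ?FF = "prod_topology (mtopology_of F) (mtopology_of F)"
    have "continuous_map ?EE ?FF ?qq"
      using contq by (simp add: continuous_map_prod_top)
    moreover have "compact_space ?EE"
      using dE by (simp add: dyn_system_def compact_space_prod_topology)
    moreover have "Hausdorff_space ?FF"
      by (simp add: Hausdorff_space_prod_topology)
    moreover have "?qq ` topspace ?EE = topspace ?FF"
      using surj by (simp add: image_paired_Times)
    ultimately have quot: "quotient_map ?EE ?FF ?qq"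
      by (rule continuous_imp_quotient_map)
    have "continuous_map ?EE (mtopology_of F) (q \<circ> (\<lambda>(x, y). x \<otimes>\<^bsub>G\<^esub> y))"
      using G by (intro continuous_map_compose[OF _ contq]) (simp add: group_rotation_def)
    then have "continuous_map ?EE (mtopology_of F) ((\<lambda>(x, y). x \<otimes>\<^bsub>H\<^esub> y) \<circ> ?qq)"
      by (rule continuous_map_eq) (auto simp: multH)
    then show "continuous_map ?FF (mtopology_of F) (\<lambda>(x, y). x \<otimes>\<^bsub>H\<^esub> y)"
      by (rule continuous_compose_quotient_map[OF quot])
    have "continuous_map (mtopology_of E) (mtopology_of F) (q \<circ> (\<lambda>x. inv\<^bsub>G\<^esub> x))"
      using G by (intro continuous_map_compose[OF _ contq]) (simp add: group_rotation_def)
    then have "continuous_map (mtopology_of E) (mtopology_of F) ((\<lambda>x. inv\<^bsub>H\<^esub> x) \<circ> q)"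
      by (rule continuous_map_eq) (simp add: hom_inv c)
    then show "continuous_map (mtopology_of F) (mtopology_of F) (\<lambda>x. inv\<^bsub>H\<^esub> x)"
      by (rule continuous_compose_quotient_map[OF factor_map_quotient_map[OF dE q]])
    show "q g \<in> carrier H"
      using factor_map_in[OF q gE] by (simp add: carrH)
    fix y
    assume "y \<in> mspace F"
    then obtain x where x: "x \<in> mspace E" "q x = y"
      by (rule factor_map_surj[OF q])
    have "P (q x) = q (Q x)"
      using q x(1) by (simp add: factor_map_def)
    also have "\<dots> = q x \<otimes>\<^bsub>H\<^esub> q g"
      using x(1) gE by (simp add: group_rotationD(4)[OF G] multH)
    finally show "P y = y \<otimes>\<^bsub>H\<^esub> q g"
      by (simp add: x(2))
  qed
  then show ?thesis
    using that hom by blast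
qed

section \<open>The universal property and the base map of the quotient\<close>

context isometric_factor_pair
begin

text \<open>Two points of \<open>Z\<close> in the same class lie below points of \<open>X\<close>
  with the same image in \<open>K\<close>, so \<open>fib\<close> makes \<open>\<phi>\<close>
  constant on classes.\<close>

lemma factor_through_rep:
  assumes \<phi>: "factor_map Z R W P \<phi>"
    and fib: "\<And>x x'. \<lbrakk>x \<in> mspace X; x' \<in> mspace X; a x = a x'\<rbrakk> \<Longrightarrow> \<phi> (p x) = \<phi> (p x')"
  obtains \<eta> where "factor_map quot quot_map W P \<eta>" "\<And>z. z \<in> mspace Z \<Longrightarrow> \<phi> z = \<eta> (rep z)"
proof (rule factor_map_descend[OF dynZ factor_map_rep \<phi>])
  fix z z'
  assume z: "z \<in> mspace Z" "z' \<in> mspace Z" and eq: "rep z = rep z'"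
  obtain x where x: "x \<in> mspace X" "p x = z"
    by (rule factor_map_surj[OF fp z(1)])
  obtain x' where "x' \<in> mspace X" "p x' = z'" "a x' = a x"
    using rep_p_eq_iff[OF x(1) z(2)] eq x(2) by auto
  then show "\<phi> z = \<phi> z'"
    using fib[OF x(1)] x(2) by metis
qed (rule that)

lemma obtain_base_map:
  obtains q where "factor_map K Q quot quot_map q" "\<And>x. x \<in> mspace X \<Longrightarrow> rep (p x) = q (a x)"
proof (rule factor_map_descend[OF dynX fa factor_map_comp[OF fp factor_map_rep]])
  fix x x'
  assume x: "x \<in> mspace X" "x' \<in> mspace X" "a x = a x'"
  then show "rep (p x) = rep (p x')"
    unfolding rep_p_eq_iff[OF x(1) p_in[OF x(2)]] by auto
qed (rule that)

text \<open>An arbitrary point over \<open>u\<close> may lie over the wrong point of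
  \<open>Z\<close>, but over one in the class of \<open>z\<close>; it can then be corrected within
  its fibre of \<open>a\<close>.\<close>

lemma base_map_lift:
  assumes q: "\<And>x. x \<in> mspace X \<Longrightarrow> rep (p x) = q (a x)"
    and u: "u \<in> mspace K" and z: "z \<in> mspace Z" and eq: "q u = rep z"
  obtains x where "x \<in> mspace X" "p x = z" "a x = u"
proof -
  obtain x where x: "x \<in> mspace X" "a x = u"
    by (rule factor_map_surj[OF fa u])
  then have "rep (p x) = rep z"
    using q[OF x(1)] eq by simp
  then obtain x' where "x' \<in> mspace X" "p x' = z" "a x' = a x"
    using rep_p_eq_iff[OF x(1) z] by auto
  then show ?thesis
    using that x(2) by simp
qed

text \<open>Balls map onto balls of the same radius: \<open>fibdist_attained\<close>, started at a
  point over \<open>u\<close>, realizes each distance from \<open>q u\<close> by a distance from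
  \<open>u\<close> in \<open>K\<close>.\<close>

lemma open_map_base_map:
  assumes q: "\<And>x. x \<in> mspace X \<Longrightarrow> rep (p x) = q (a x)"
  shows "open_map (mtopology_of K) (mtopology_of quot) q"
  unfolding open_map_def
proof (intro allI impI)
  interpret K: Metric_space "mspace K" "mdist K"
    by simp
  interpret W: Metric_space "mspace quot" "mdist quot"
    by simp
  fix U
  assume U: "openin (mtopology_of K) U"
  then have UK: "U \<subseteq> mspace K"
    using openin_subset by fastforce
  have "\<exists>r>0. W.mball (q u) r \<subseteq> q ` U" and "q u \<in> mspace quot" if "u \<in> U" for u
  proof -
    note uU = that
    have u: "u \<in> mspace K"
      using UK uU by blast
    obtain x where x: "x \<in> mspace X" "a x = u"
      by (rule factor_map_surj[OF fa u])
    show "q u \<in> mspace quot"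
      using p_in[OF x(1)] by (simp add: mspace_quot flip: x(2) q[OF x(1)])
    obtain r where "r > 0" and r: "K.mball u r \<subseteq> U"
      using U uU unfolding mtopology_of_def K.openin_mtopology by blast
    have "w \<in> q ` U" if w: "w \<in> W.mball (q u) r" for w
    proof -
      have "w \<in> mspace quot"
        using w by simp
      then have "w \<in> rep ` mspace Z"
        by (simp only: mspace_quot)
      then obtain z where z: "w = rep z" "z \<in> mspace Z"
        by (rule imageE)
      obtain x' where x': "x' \<in> mspace X" "p x' = z" "mdist K (a x) (a x') = fibdist (p x) z"
        by (rule fibdist_attained[OF x(1) z(2)])
      have "mdist K u (a x') < r"
        using w mdist_quot[OF p_in[OF x(1)] z(2)] q[OF x(1)] x'(3) x(2) z(1) by simp
      then have "a x' \<in> U"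
        using r u a_in[OF x'(1)] by auto
      moreover have "w = q (a x')"
        using q[OF x'(1)] x'(2) z(1) by simp
      ultimately show ?thesis
        by blast
    qed
    then show "\<exists>r>0. W.mball (q u) r \<subseteq> q ` U"
      using \<open>r > 0\<close> by blast
  qed
  then show "openin (mtopology_of quot) (q ` U)"
    unfolding mtopology_of_def W.openin_mtopology by blast
qed

end

text \<open>Only the metric of \<open>E\<close> changes. Being a system and being a factor map
  depend on the carrier and the topology, so these properties carry over.\<close>

lemma isometric_factor_pair_exists:
  fixes E :: "'e metric"
  assumes X: "minimal_system X T" and E: "equicontinuous_system E Q" and a: "factor_map X T E Q a"
    and Z: "dyn_system Z R" and p: "factor_map X T Z R p"
  obtains K :: "'e metric" where "mspace K = mspace E" "mtopology_of K = mtopology_of E"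
    "isometric_factor_pair X T K Q a Z R p"
proof -
  obtain K :: "'e metric" where K: "mspace K = mspace E" "mtopology_of K = mtopology_of E"
    "\<And>u v. u \<in> mspace E \<Longrightarrow> v \<in> mspace E \<Longrightarrow> mdist K (Q u) (Q v) = mdist K u v"
    by (rule equicontinuous_invariant_metric[OF E]) blast
  show ?thesis
  proof (rule that[OF K(1,2)])
    show "isometric_factor_pair X T K Q a Z R p"
    proof
      show "dyn_system K Q"
        using E K(2) by (simp add: equicontinuous_system_def dyn_system_def)
      show "factor_map X T K Q a"
        using a K(1,2) by (simp add: factor_map_def)
    qed (use X Z p K in simp_all)
  qed
qed

section \<open>Products and joinings\<close>

lemma bij_betw_prod_system:
  assumes "dyn_system X T" "dyn_system Y S"
  shows "bij_betw (map_prod T S) (mspace X \<times> mspace Y) (mspace X \<times> mspace Y)"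
  by (intro bij_betw_map_prod dyn_system_bij assms)

lemma continuous_map_map_prod_id:
  assumes "continuous_map A B f"
  shows "continuous_map (prod_topology A C) (prod_topology B C) (map_prod f id)"
proof -
  have "continuous_map (prod_topology A C) (prod_topology B C) (\<lambda>(x, y). (f x, id y))"
    using assms by (simp add: continuous_map_prod_top)
  then show ?thesis
    by (simp add: map_prod_def)
qed

text \<open>The map \<open>h\<close> is closed, it sends orbits to orbits, and it sends the closure
  of an orbit into the closure of the image orbit.\<close>

lemma minimal_subset_image:
  assumes A: "compact_space A" and B: "Hausdorff_space B" and h: "continuous_map A B h"
    and f: "bij_betw f (topspace A) (topspace A)" and f': "bij_betw f' (topspace B) (topspace B)"
    and hf: "\<And>x. x \<in> topspace A \<Longrightarrow> h (f x) = f' (h x)" and M: "minimal_subset A f M"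
  shows "minimal_subset B f' (h ` M)"
  unfolding minimal_subset_def
proof (intro conjI ballI)
  have M_cl: "closedin A M" and fM: "f ` M = M" and "M \<noteq> {}"
    using M by (simp_all add: minimal_subset_def)
  then have MA: "M \<subseteq> topspace A"
    using closedin_subset by blast
  show "h ` M \<noteq> {}"
    using \<open>M \<noteq> {}\<close> by simp
  show "closedin B (h ` M)"
    using continuous_imp_closed_map[OF h A B] M_cl by (simp add: closed_map_def)
  have "f' ` h ` M = h ` f ` M"
    unfolding image_image using MA by (intro image_cong refl) (metis hf subsetD)
  then show "f' ` h ` M = h ` M"
    by (simp add: fM)
  fix y
  assume "y \<in> h ` M"
  then obtain x where x: "y = h x" "x \<in> M"
    by (rule imageE)
  have hA: "h ` topspace A \<subseteq> topspace B"
    using continuous_map_image_subset_topspace[OF h] .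
  have "M \<subseteq> A closure_of zorbit (topspace A) f x"
    using M x(2) by (simp add: minimal_subset_def)
  then have "h ` M \<subseteq> h ` (A closure_of zorbit (topspace A) f x)"
    by (rule image_mono)
  also have "\<dots> \<subseteq> B closure_of (h ` zorbit (topspace A) f x)"
    by (rule continuous_map_image_closure_subset[OF h])
  also have "h ` zorbit (topspace A) f x = zorbit (topspace B) f' y"
    unfolding zorbit_def image_image x(1)
    using ziter_equivariant[OF f f' hA hf] MA x(2) by (intro image_cong refl) blast
  finally show "h ` M \<subseteq> B closure_of zorbit (topspace B) f' y" .
qed

lemma joining_full:
  assumes "minimal_system X T" "minimal_system Y S"
  shows "joining X T Y S (mspace X \<times> mspace Y)"
proof -
  have "closedin (prod_topology (mtopology_of X) (mtopology_of Y)) (mspace X \<times> mspace Y)"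
    using closedin_topspace[of "prod_topology (mtopology_of X) (mtopology_of Y)"] by simp
  moreover have "map_prod T S ` (mspace X \<times> mspace Y) = mspace X \<times> mspace Y"
    using assms by (intro bij_betw_imp_surj_on bij_betw_prod_system) (simp_all add: minimal_system_def)
  ultimately show ?thesis
    using assms by (simp add: joining_def minimal_system_def)
qed

lemma joining_preimage:
  assumes X: "dyn_system X T" and Y: "dyn_system Y S" and Z: "dyn_system Z R"
    and p: "factor_map X T Z R p" and J: "joining Z R Y S J"
  shows "joining X T Y S {w \<in> mspace X \<times> mspace Y. map_prod p id w \<in> J}" (is "joining X T Y S ?J")
  unfolding joining_def
proof (intro conjI)
  have J_cl: "closedin (prod_topology (mtopology_of Z) (mtopology_of Y)) J"
    and J_inv: "map_prod R S ` J = J" and J1: "fst ` J = mspace Z" and J2: "snd ` J = mspace Y"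
    using J by (simp_all add: joining_def)
  have JZ: "J \<subseteq> mspace Z \<times> mspace Y"
    using closedin_subset[OF J_cl] by simp
  show "closedin (prod_topology (mtopology_of X) (mtopology_of Y)) ?J"
    using closedin_continuous_map_preimage[OF continuous_map_map_prod_id[OF factor_map_continuous[OF p]] J_cl]
    by simp
  have bXY: "bij_betw (map_prod T S) (mspace X \<times> mspace Y) (mspace X \<times> mspace Y)"
    and bZY: "bij_betw (map_prod R S) (mspace Z \<times> mspace Y) (mspace Z \<times> mspace Y)"
    using bij_betw_prod_system X Y Z by blast+
  have eq: "map_prod p id (map_prod T S w) = map_prod R S (map_prod p id w)"
    if "w \<in> mspace X \<times> mspace Y" for w
    using p that by (auto simp: factor_map_def)
  have pw: "map_prod p id w \<in> mspace Z \<times> mspace Y" if "w \<in> mspace X \<times> mspace Y" for w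
    using factor_map_in[OF p] that by auto
  show "map_prod T S ` ?J = ?J"
  proof (rule subset_antisym; rule subsetI)
    fix w
    assume "w \<in> map_prod T S ` ?J"
    then obtain v where v: "w = map_prod T S v" "v \<in> ?J"
      by (rule imageE)
    then have "map_prod p id w \<in> map_prod R S ` J"
      using eq[of v] by simp
    then show "w \<in> ?J"
      using v bij_betw_apply[OF bXY, of v] by (simp add: J_inv)
  next
    fix w
    assume w: "w \<in> ?J"
    then have "w \<in> map_prod T S ` (mspace X \<times> mspace Y)"
      using bij_betw_imp_surj_on[OF bXY] by simp
    then obtain v where v: "w = map_prod T S v" "v \<in> mspace X \<times> mspace Y"
      by (rule imageE)
    have "map_prod p id w \<in> map_prod R S ` J"
      using w by (simp add: J_inv)
    then obtain j where j: "map_prod p id w = map_prod R S j" "j \<in> J"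
      by (rule imageE)
    \<comment> \<open>Invariance of \<open>J\<close> supplies only some \<open>j\<close> in
      \<open>J\<close> with the right image; injectivity on the product of \<open>Z\<close> and
      \<open>Y\<close> identifies it with the image of \<open>v\<close>.\<close>
    have "map_prod p id v = j"
      using eq[OF v(2)] v(1) j(1)
      by (intro inj_onD[OF bij_betw_imp_inj_on[OF bZY] _ pw[OF v(2)] subsetD[OF JZ j(2)]]) simp
    then show "w \<in> map_prod T S ` ?J"
      using v j(2) by simp
  qed
  show "fst ` ?J = mspace X"
  proof (rule subset_antisym; rule subsetI)
    fix x
    assume x: "x \<in> mspace X"
    then have "p x \<in> fst ` J"
      using factor_map_in[OF p x] by (simp add: J1)
    then obtain j where j: "p x = fst j" "j \<in> J"
      by (rule imageE)
    then have "(x, snd j) \<in> ?J"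
      using x subsetD[OF JZ j(2)] by (auto simp: mem_Times_iff)
    then show "x \<in> fst ` ?J"
      by (rule image_eqI[rotated]) simp
  qed auto
  show "snd ` ?J = mspace Y"
  proof (rule subset_antisym; rule subsetI)
    fix y
    assume y: "y \<in> mspace Y"
    then have "y \<in> snd ` J"
      by (simp add: J2)
    then obtain j where j: "y = snd j" "j \<in> J"
      by (rule imageE)
    have "fst j \<in> mspace Z"
      using subsetD[OF JZ j(2)] by (simp add: mem_Times_iff)
    then obtain x where x: "x \<in> mspace X" "p x = fst j"
      by (rule factor_map_surj[OF p])
    then have "(x, y) \<in> ?J"
      using j y by simp
    then show "y \<in> snd ` ?J"
      by (rule image_eqI[rotated]) simp
  qed auto
qed

section \<open>Factors of quasi-disjoint systems\<close>

lemma quasi_disjoint_factor: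
  fixes X :: "'a metric" and Y :: "'b metric" and Z :: "'c metric"
  assumes Z: "dyn_system Z R" and p: "factor_map X T Z R p" and qd: "quasi_disjoint X T Y S"
  shows "quasi_disjoint Z R Y S"
proof -
  have X: "minimal_system X T" and Y: "minimal_system Y S"
    using qd by (simp_all add: quasi_disjoint_def)
  then have dX: "dyn_system X T" and dY: "dyn_system Y S"
    by (simp_all add: minimal_system_def)
  have mZ: "minimal_system Z R"
    by (rule minimal_system_factor[OF X Z p])
  obtain Xeq :: "'a metric" and Tq \<pi>X and Yeq :: "'b metric" and Sq \<pi>Y
    where Xeq: "max_eq_factor X T Xeq Tq \<pi>X" and Yeq: "max_eq_factor Y S Yeq Sq \<pi>Y"
      and joins: "\<forall>J. joining X T Y S J \<and> map_prod \<pi>X \<pi>Y ` J = mspace Xeq \<times> mspace Yeq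
        \<longleftrightarrow> J = mspace X \<times> mspace Y"
    using qd unfolding quasi_disjoint_def by (elim conjE exE) (rule that)
  have eqX: "equicontinuous_system Xeq Tq" and fX: "factor_map X T Xeq Tq \<pi>X"
    using Xeq by (simp_all add: max_eq_factor_def)
  have fY: "factor_map Y S Yeq Sq \<pi>Y"
    using Yeq by (simp add: max_eq_factor_def)
  obtain K :: "'a metric" where K: "mspace K = mspace Xeq" "mtopology_of K = mtopology_of Xeq"
      "isometric_factor_pair X T K Tq \<pi>X Z R p"
    by (rule isometric_factor_pair_exists[OF X eqX fX Z p])
  interpret isometric_factor_pair X T K Tq \<pi>X Z R p
    by (rule K(3))
  obtain q where q: "factor_map K Tq quot quot_map q" "\<And>x. x \<in> mspace X \<Longrightarrow> rep (p x) = q (\<pi>X x)"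
    by (rule obtain_base_map) blast
  have max: "max_eq_factor Z R quot quot_map rep"
    unfolding max_eq_factor_def
  proof (intro conjI allI impI equicontinuous_quot factor_map_rep, elim conjE)
    fix W :: "'c metric" and P \<phi>
    assume W: "equicontinuous_system W P" and \<phi>: "factor_map Z R W P \<phi>"
    \<comment> \<open>Universality of \<open>Xeq\<close> is applied to \<open>\<phi>\<close>
      composed with \<open>p\<close>, merely to see that this map is constant on the fibres of
      \<open>\<pi>X\<close>. The version for arbitrary types is called for because \<open>W\<close>
      lives on the type of \<open>Z\<close>.\<close>
    obtain \<eta> where \<eta>: "\<forall>x\<in>mspace X. \<phi> (p x) = \<eta> (\<pi>X x)"
      using max_eq_factor_universal[OF Xeq W factor_map_comp[OF p \<phi>]] by (elim exE conjE) (rule that)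
    obtain \<eta>' where "factor_map quot quot_map W P \<eta>'" "\<And>z. z \<in> mspace Z \<Longrightarrow> \<phi> z = \<eta>' (rep z)"
      using factor_through_rep[OF \<phi>] \<eta> by metis
    then show "\<exists>\<eta>. factor_map quot quot_map W P \<eta> \<and> (\<forall>z\<in>mspace Z. \<phi> z = \<eta> (rep z))"
      by (intro exI[of _ \<eta>'] conjI ballI)
  qed
  have iff: "joining Z R Y S J \<and> map_prod rep \<pi>Y ` J = mspace quot \<times> mspace Yeq
      \<longleftrightarrow> J = mspace Z \<times> mspace Y" for J
  proof
    assume "J = mspace Z \<times> mspace Y"
    moreover have "map_prod rep \<pi>Y ` (mspace Z \<times> mspace Y) = mspace quot \<times> mspace Yeq"
      using fY by (simp add: map_prod_image mspace_quot factor_map_def)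
    ultimately show "joining Z R Y S J \<and> map_prod rep \<pi>Y ` J = mspace quot \<times> mspace Yeq"
      using joining_full[OF mZ Y] by simp
  next
    assume "joining Z R Y S J \<and> map_prod rep \<pi>Y ` J = mspace quot \<times> mspace Yeq"
    then have J: "joining Z R Y S J" and img: "map_prod rep \<pi>Y ` J = mspace quot \<times> mspace Yeq"
      by simp_all
    have JZ: "J \<subseteq> mspace Z \<times> mspace Y"
      using J closedin_subset[of _ J] by (fastforce simp: joining_def)
    \<comment> \<open>Quasi-disjointness of \<open>X\<close> and \<open>Y\<close> is applied to the
      preimage of \<open>J\<close>. It is a joining by \<open>joining_preimage\<close>; what has to
      be shown is that its image is all of \<open>Xeq \<times> Yeq\<close>.\<close>
    let ?J = "{w \<in> mspace X \<times> mspace Y. map_prod p id w \<in> J}"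
    have "map_prod \<pi>X \<pi>Y ` ?J = mspace Xeq \<times> mspace Yeq"
    proof (rule subset_antisym; rule subsetI)
      fix e
      assume "e \<in> map_prod \<pi>X \<pi>Y ` ?J"
      then show "e \<in> mspace Xeq \<times> mspace Yeq"
        using factor_map_in[OF fX] factor_map_in[OF fY] by auto
    next
      fix e
      assume e: "e \<in> mspace Xeq \<times> mspace Yeq"
      then have e1: "fst e \<in> mspace K" and "snd e \<in> mspace Yeq"
        by (simp_all add: K(1) mem_Times_iff)
      then have "(q (fst e), snd e) \<in> map_prod rep \<pi>Y ` J"
        using factor_map_in[OF q(1) e1] by (simp add: img)
      then obtain j where j: "(q (fst e), snd e) = map_prod rep \<pi>Y j" "j \<in> J"
        by (rule imageE)
      then have jZ: "fst j \<in> mspace Z" "snd j \<in> mspace Y"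
        using JZ by (auto simp: mem_Times_iff)
      have "q (fst e) = rep (fst j)" "snd e = \<pi>Y (snd j)"
        using j(1) by (simp_all add: prod_eq_iff)
      \<comment> \<open>The lift has prescribed images both in \<open>Z\<close> and in
        \<open>Xeq\<close>, so \<open>(x, snd j)\<close> lies in \<open>?J\<close> and maps to
        \<open>e\<close>.\<close>
      then obtain x where x: "x \<in> mspace X" "p x = fst j" "\<pi>X x = fst e"
        using base_map_lift[OF q(2) e1 jZ(1)] by blast
      have "(x, snd j) \<in> ?J"
        using x jZ j(2) by simp
      moreover have "e = map_prod \<pi>X \<pi>Y (x, snd j)"
        using x(3) \<open>snd e = \<pi>Y (snd j)\<close> by (simp add: prod_eq_iff)
      ultimately show "e \<in> map_prod \<pi>X \<pi>Y ` ?J"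
        by blast
    qed
    then have full: "?J = mspace X \<times> mspace Y"
      by (rule joins[rule_format, THEN iffD1, OF conjI[OF joining_preimage[OF dX dY Z p J]]])
    have "(z, y) \<in> J" if z: "z \<in> mspace Z" and y: "y \<in> mspace Y" for z y
    proof -
      obtain x where x: "x \<in> mspace X" "p x = z"
        by (rule factor_map_surj[OF p z])
      then have "(x, y) \<in> ?J"
        unfolding full using y by simp
      then show ?thesis
        using x by simp
    qed
    then show "J = mspace Z \<times> mspace Y"
      using JZ by auto
  qed
  show ?thesis
    unfolding quasi_disjoint_def by (intro conjI exI allI) (rule mZ Y max Yeq iff)+
qed

section \<open>The case of strong quasi-disjointness\<close>

lemma strongly_quasi_disjoint_factor:
  fixes X :: "'a metric" and Y :: "'b metric" and Z :: "'c metric"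
  assumes Z: "dyn_system Z R" and p: "factor_map X T Z R p" and sqd: "strongly_quasi_disjoint X T Y S"
  shows "strongly_quasi_disjoint Z R Y S"
proof -
  have X: "minimal_system X T" and Y: "minimal_system Y S"
    using sqd by (simp_all add: strongly_quasi_disjoint_def)
  then have dX: "dyn_system X T" and dY: "dyn_system Y S"
    by (simp_all add: minimal_system_def)
  have mZ: "minimal_system Z R"
    by (rule minimal_system_factor[OF X Z p])
  let ?XY = "prod_topology (mtopology_of X) (mtopology_of Y)"
    and ?ZY = "prod_topology (mtopology_of Z) (mtopology_of Y)"
  obtain E :: "'a metric" and Q G g \<alpha> \<beta> \<Omega>
    where Emax: "max_common_eq_factor X T Y S E Q \<alpha> \<beta>" and G: "group_rotation E Q G g"
      and \<Omega>: "residual_in (mtopology_of E) \<Omega>"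
      and min: "\<forall>e\<in>\<Omega>. minimal_subset ?XY (map_prod T S)
        {(x, y). x \<in> mspace X \<and> y \<in> mspace Y \<and> \<alpha> x \<otimes>\<^bsub>G\<^esub> inv\<^bsub>G\<^esub> (\<beta> y) = e}"
    using sqd unfolding strongly_quasi_disjoint_def by (elim conjE exE) (rule that)
  have eqE: "equicontinuous_system E Q" and f\<alpha>: "factor_map X T E Q \<alpha>" and f\<beta>: "factor_map Y S E Q \<beta>"
    using Emax by (simp_all add: max_common_eq_factor_def)
  have dE: "dyn_system E Q"
    using eqE by (simp add: equicontinuous_system_def)
  have mE: "minimal_system E Q"
    by (rule minimal_system_factor[OF X dE f\<alpha>])
  obtain K :: "'a metric" where K: "mspace K = mspace E" "mtopology_of K = mtopology_of E"
      "isometric_factor_pair X T K Q \<alpha> Z R p"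
    by (rule isometric_factor_pair_exists[OF X eqE f\<alpha> Z p])
  interpret isometric_factor_pair X T K Q \<alpha> Z R p
    by (rule K(3))
  obtain q where qK: "factor_map K Q quot quot_map q" and q: "\<And>x. x \<in> mspace X \<Longrightarrow> rep (p x) = q (\<alpha> x)"
    by (rule obtain_base_map) blast
  have fq: "factor_map E Q quot quot_map q"
    using qK by (simp add: factor_map_def K)
  obtain H h where H: "group_rotation quot quot_map H h" and hom: "q \<in> hom G H"
    by (rule group_rotation_factor[OF G mE dyn_system_quot fq])
  interpret G: comm_group G
    by (rule group_rotationD(1)[OF G])
  interpret H: comm_group H
    by (rule group_rotationD(1)[OF H])
  interpret q: group_hom G H q
    using hom by unfold_locales
  note carr = group_rotationD(2)[OF G]
  \<comment> \<open>With the homomorphism \<open>q\<close> applied on both sides, the difference map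
    of \<open>Z\<close> and \<open>Y\<close> at \<open>(p x, y)\<close> is \<open>q\<close> of the
    difference map of \<open>X\<close> and \<open>Y\<close> at \<open>(x, y)\<close>.\<close>
  define \<beta>' where "\<beta>' y = q (\<beta> y)" for y
  have f\<beta>': "factor_map Y S quot quot_map \<beta>'"
    using factor_map_comp[OF f\<beta> fq] by (simp add: \<beta>'_def[abs_def])
  have max: "max_common_eq_factor Z R Y S quot quot_map rep \<beta>'"
    unfolding max_common_eq_factor_def
  proof (intro conjI allI impI equicontinuous_quot factor_map_rep f\<beta>', elim conjE)
    fix W :: "'c metric" and P \<phi> \<psi>
    assume W: "equicontinuous_system W P" and \<phi>: "factor_map Z R W P \<phi>" and \<psi>: "factor_map Y S W P \<psi>"
    have dW: "dyn_system W P"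
      using W by (simp add: equicontinuous_system_def)
    obtain \<eta>1 \<eta>2 where \<eta>1: "factor_map E Q W P \<eta>1" and \<eta>2: "factor_map E Q W P \<eta>2"
      and \<phi>\<eta>: "\<forall>x\<in>mspace X. \<phi> (p x) = \<eta>1 (\<alpha> x)" and \<psi>\<eta>: "\<forall>y\<in>mspace Y. \<psi> y = \<eta>2 (\<beta> y)"
      using max_common_eq_factor_universal[OF Emax W factor_map_comp[OF p \<phi>] \<psi>]
      by (elim exE conjE) (rule that)
    obtain \<eta>1' where \<eta>1': "factor_map quot quot_map W P \<eta>1'"
      and \<phi>\<eta>1': "\<And>z. z \<in> mspace Z \<Longrightarrow> \<phi> z = \<eta>1' (rep z)"
      using factor_through_rep[OF \<phi>] \<phi>\<eta> by metis
    have \<eta>1q: "\<eta>1 u = \<eta>1' (q u)" if u: "u \<in> mspace E" for u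
    proof -
      obtain x where x: "x \<in> mspace X" "\<alpha> x = u"
        by (rule factor_map_surj[OF f\<alpha> u])
      have "\<eta>1 (\<alpha> x) = \<eta>1' (q (\<alpha> x))"
        using \<phi>\<eta>[rule_format, OF x(1)] \<phi>\<eta>1'[OF p_in[OF x(1)]] q[OF x(1)] by simp
      then show ?thesis
        by (simp only: x(2))
    qed
    \<comment> \<open>Factoring \<open>\<phi>\<close> through \<open>Z\<close> shows only that
      \<open>\<eta>1\<close> is constant on the fibres of \<open>q\<close>. Since
      \<open>\<eta>2\<close> is a translate of \<open>\<eta>1\<close> and \<open>q\<close> is a
      homomorphism, the same holds for \<open>\<eta>2\<close>.\<close>
    obtain c where c: "c \<in> mspace E" "\<And>u. u \<in> mspace E \<Longrightarrow> \<eta>2 u = \<eta>1 (c \<otimes>\<^bsub>G\<^esub> u)"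
      by (rule group_rotation_factor_maps_translate[OF G mE dW \<eta>1 \<eta>2]) blast
    have \<eta>2c: "\<eta>2 u = \<eta>1' (q c \<otimes>\<^bsub>H\<^esub> q u)" if u: "u \<in> mspace E" for u
      using c(2)[OF u] \<eta>1q[of "c \<otimes>\<^bsub>G\<^esub> u"] G.m_closed[of c u] q.hom_mult[of c u] c(1) u by (simp add: carr)
    obtain \<eta>2' where \<eta>2': "factor_map quot quot_map W P \<eta>2'" "\<And>u. u \<in> mspace E \<Longrightarrow> \<eta>2 u = \<eta>2' (q u)"
      using factor_map_descend[OF dE fq \<eta>2] \<eta>2c by metis
    have "\<psi> y = \<eta>2' (\<beta>' y)" if "y \<in> mspace Y" for y
      using \<psi>\<eta>[rule_format, OF that] \<eta>2'(2)[OF factor_map_in[OF f\<beta> that]] by (simp add: \<beta>'_def)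
    then show "\<exists>\<eta>1 \<eta>2. factor_map quot quot_map W P \<eta>1 \<and> factor_map quot quot_map W P \<eta>2 \<and>
        (\<forall>z\<in>mspace Z. \<phi> z = \<eta>1 (rep z)) \<and> (\<forall>y\<in>mspace Y. \<psi> y = \<eta>2 (\<beta>' y))"
      using \<eta>1' \<phi>\<eta>1' \<eta>2'(1) by (intro exI[of _ \<eta>1'] exI[of _ \<eta>2'] conjI ballI)
  qed
  have res: "residual_in (mtopology_of quot) (q ` \<Omega>)"
  proof (rule residual_in_open_map_image[OF _ _ _ _ \<Omega>])
    show "compact_space (mtopology_of E)"
      using dE by (simp add: dyn_system_def)
    show "continuous_map (mtopology_of E) (mtopology_of quot) q"
      by (rule factor_map_continuous[OF fq])
    show "open_map (mtopology_of E) (mtopology_of quot) q"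
      using open_map_base_map[OF q] by (simp add: K(2))
    show "q ` mspace E = mspace quot"
      using fq by (simp add: factor_map_def)
  qed
  have "minimal_subset ?ZY (map_prod R S)
      {(z, y). z \<in> mspace Z \<and> y \<in> mspace Y \<and> rep z \<otimes>\<^bsub>H\<^esub> inv\<^bsub>H\<^esub> (\<beta>' y) = q e}" (is "minimal_subset _ _ ?B")
    if e: "e \<in> \<Omega>" for e
  proof -
    let ?A = "{(x, y). x \<in> mspace X \<and> y \<in> mspace Y \<and> \<alpha> x \<otimes>\<^bsub>G\<^esub> inv\<^bsub>G\<^esub> (\<beta> y) = e}"
    have eE: "e \<in> carrier G"
      using \<Omega> e by (auto simp: residual_in_def carr)
    have \<alpha>G: "\<alpha> x \<in> carrier G" if "x \<in> mspace X" for x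
      using factor_map_in[OF f\<alpha> that] by (simp add: carr)
    have \<beta>G: "\<beta> y \<in> carrier G" if "y \<in> mspace Y" for y
      using factor_map_in[OF f\<beta> that] by (simp add: carr)
    \<comment> \<open>Equality of the two fibres is where lifting enters: a homomorphism alone gives
      only the inclusion of the image in \<open>?B\<close>.\<close>
    have "map_prod p id ` ?A = ?B"
    proof (rule subset_antisym; rule subsetI)
      fix w
      assume "w \<in> map_prod p id ` ?A"
      then obtain x y where w: "w = (p x, y)" and x: "x \<in> mspace X" and y: "y \<in> mspace Y"
        and xy: "\<alpha> x \<otimes>\<^bsub>G\<^esub> inv\<^bsub>G\<^esub> (\<beta> y) = e"
        by auto
      have "rep (p x) \<otimes>\<^bsub>H\<^esub> inv\<^bsub>H\<^esub> (\<beta>' y) = q (\<alpha> x \<otimes>\<^bsub>G\<^esub> inv\<^bsub>G\<^esub> (\<beta> y))"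
        using \<alpha>G[OF x] \<beta>G[OF y] by (simp add: q[OF x] \<beta>'_def)
      then show "w \<in> ?B"
        using w p_in[OF x] y xy by simp
    next
      fix w
      assume "w \<in> ?B"
      then obtain z y where w: "w = (z, y)" and z: "z \<in> mspace Z" and y: "y \<in> mspace Y"
        and zy: "rep z \<otimes>\<^bsub>H\<^esub> inv\<^bsub>H\<^esub> (q (\<beta> y)) = q e"
        by (auto simp: \<beta>'_def)
      have rz: "rep z \<in> carrier H"
        using factor_map_in[OF factor_map_rep z] by (simp add: group_rotationD(2)[OF H])
      have "q (e \<otimes>\<^bsub>G\<^esub> \<beta> y) = q e \<otimes>\<^bsub>H\<^esub> q (\<beta> y)"
        using eE \<beta>G[OF y] by simp
      also have "\<dots> = rep z"
        using rz q.hom_closed[OF \<beta>G[OF y]] by (simp add: H.m_assoc flip: zy)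
      finally obtain x where x: "x \<in> mspace X" "p x = z" "\<alpha> x = e \<otimes>\<^bsub>G\<^esub> \<beta> y"
        using base_map_lift[OF q _ z, of "e \<otimes>\<^bsub>G\<^esub> \<beta> y"] G.m_closed[OF eE \<beta>G[OF y]] by (auto simp: carr K(1))
      have "\<alpha> x \<otimes>\<^bsub>G\<^esub> inv\<^bsub>G\<^esub> (\<beta> y) = e"
        using eE \<beta>G[OF y] by (simp add: x(3) G.m_assoc)
      then have "(x, y) \<in> ?A"
        using x(1) y by simp
      moreover have "w = map_prod p id (x, y)"
        by (simp add: w x(2))
      ultimately show "w \<in> map_prod p id ` ?A"
        by (rule image_eqI[rotated])
    qed
    moreover have "minimal_subset ?ZY (map_prod R S) (map_prod p id ` ?A)"
    proof (rule minimal_subset_image[OF _ _ _ _ _ _ min[rule_format, OF e]])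
      show "compact_space ?XY"
        using dX dY by (simp add: dyn_system_def compact_space_prod_topology)
      show "Hausdorff_space ?ZY"
        by (simp add: Hausdorff_space_prod_topology)
      show "continuous_map ?XY ?ZY (map_prod p id)"
        by (rule continuous_map_map_prod_id[OF cont_p])
      show "bij_betw (map_prod T S) (topspace ?XY) (topspace ?XY)"
        using bij_betw_prod_system[OF dX dY] by simp
      show "bij_betw (map_prod R S) (topspace ?ZY) (topspace ?ZY)"
        using bij_betw_prod_system[OF Z dY] by simp
      show "map_prod p id (map_prod T S w) = map_prod R S (map_prod p id w)" if "w \<in> topspace ?XY" for w
        using that p_T[of "fst w"] by (simp add: prod_eq_iff mem_Times_iff)
    qed
    ultimately show ?thesis
      by simp
  qed
  then have min': "\<forall>z\<in>q ` \<Omega>. minimal_subset ?ZY (map_prod R S)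
      {(x, y). x \<in> mspace Z \<and> y \<in> mspace Y \<and> rep x \<otimes>\<^bsub>H\<^esub> inv\<^bsub>H\<^esub> (\<beta>' y) = z}"
    by (simp only: ball_simps) (rule ballI)
  show ?thesis
    unfolding strongly_quasi_disjoint_def by (intro conjI exI) (rule mZ Y max H res min')+
qed

theorem theorem1p2:
  fixes X :: "'a metric" and Y :: "'b metric" and Z :: "'c metric"
    and T :: "'a \<Rightarrow> 'a" and S :: "'b \<Rightarrow> 'b" and R :: "'c \<Rightarrow> 'c" and \<pi> :: "'a \<Rightarrow> 'c"
  assumes "minimal_system X T" and "minimal_system Y S"
    and "dyn_system Z R" and "factor_map X T Z R \<pi>"
  shows "(quasi_disjoint X T Y S \<longrightarrow> quasi_disjoint Z R Y S) \<and>
         (strongly_quasi_disjoint X T Y S \<longrightarrow> strongly_quasi_disjoint Z R Y S)"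
  using quasi_disjoint_factor[OF assms(3,4)] strongly_quasi_disjoint_factor[OF assms(3,4)] by blast

end
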